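(* Let $\theta\in H^\infty$ be inner, let $\phi,\psi\in L^\infty$ be unimodular with $\phi K_\theta\perp\psi K_\theta$ and such that neither $\phi\overline\psi$ nor $\overline\phi\psi$ is a constant multiple of $\theta$, and let $M=\phi K_\theta\oplus\psi K_\theta$. For $g\in L^\infty$, the dual-band Toeplitz operator $T^M_g$ on $M$ is equivalent after extension to the Toeplitz operator $T_{\mathcal G}$ on $(H^2)^4$ with symbol $$\mathcal G=\begin{pmatrix}\overline\theta&0&0&0\\0&\overline\theta&0&0\\ g&g\overline\phi\psi&\theta&0\\ g\phi\overline\psi&g&0&\theta\end{pmatrix}.$$
   Context: All function spaces are on the unit circle $\mathbb T$; $H^2,H^\infty$ are the Hardy spaces of the unit disc. For $\theta$ inner, $K_\theta=H^2\ominus\theta H^2$. $M=\phi K_\theta\oplus\psi K_\theta$ (orthogonal sum) is a closed subspace of $L^2=L^2(\mathbb T)$ with orthogonal projection $P_M$, and $T^M_gf=P_M(gf)$ for $f\in M$. For $\mathcal G\in(L^\infty)^{4\times4}$, $T_{\mathcal G}f=P^+(\mathcal Gf)$ on $(H^2)^4$, with $P^+$ the orthogonal projection from $L^2$ onto $H^2$ applied componentwise. Operators $T:X\to\widetilde X$ and $S:Y\to\widetilde Y$ are equivalent after extension if there exist (possibly trivial) Banach spaces $X_0,Y_0$ and invertible bounded linear operators $E:\widetilde Y\oplus Y_0\to\widetilde X\oplus X_0$ and $F:X\oplus X_0\to Y\oplus Y_0$ such that $\begin{pmatrix}T&0\\0&I_{X_0}\end{pmatrix}=E\begin{pmatrix}S&0\\0&I_{Y_0}\end{pmatrix}F$.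 *)

theory Defs
  imports "HOL-Analysis.Analysis"
begin

section \<open>Complex normed spaces and equivalence after extension\<close>

class complex_normed_vector = real_normed_vector +
  fixes scaleC :: "complex \<Rightarrow> 'a \<Rightarrow> 'a" (infixr "*\<^sub>C" 75)
  assumes scaleC_add_right: "c *\<^sub>C (x + y) = c *\<^sub>C x + c *\<^sub>C y"
    and scaleC_add_left: "(c + d) *\<^sub>C x = c *\<^sub>C x + d *\<^sub>C x"
    and scaleC_scaleC: "c *\<^sub>C d *\<^sub>C x = (c * d) *\<^sub>C x"
    and scaleC_of_real: "complex_of_real r *\<^sub>C x = r *\<^sub>R x"
    and norm_scaleC: "norm (c *\<^sub>C x) = cmod c * norm x"

instantiation prod :: (complex_normed_vector, complex_normed_vector) complex_normed_vector
begin

definition scaleC_prod :: "complex \<Rightarrow> 'a \<times> 'b \<Rightarrow> 'a \<times> 'b" where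
  "scaleC_prod c p = (c *\<^sub>C fst p, c *\<^sub>C snd p)"

instance
proof
  fix c :: complex and x :: "'a \<times> 'b"
  have "norm (c *\<^sub>C x) = sqrt ((cmod c)\<^sup>2 * ((norm (fst x))\<^sup>2 + (norm (snd x))\<^sup>2))"
    by (simp add: scaleC_prod_def norm_prod_def norm_scaleC power_mult_distrib distrib_left)
  then show "norm (c *\<^sub>C x) = cmod c * norm x"
    by (simp add: real_sqrt_mult norm_prod_def)
qed (auto simp: scaleC_prod_def scaleC_add_right scaleC_add_left scaleC_scaleC scaleC_of_real
      prod_eq_iff)

end

instantiation vec :: (complex_normed_vector, finite) complex_normed_vector
begin

definition scaleC_vec :: "complex \<Rightarrow> 'a ^ 'b \<Rightarrow> 'a ^ 'b" where
  "scaleC_vec c x = (\<chi> i. c *\<^sub>C (x $ i))"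

instance
proof
  fix c :: complex and x :: "'a ^ 'b"
  show "norm (c *\<^sub>C x) = cmod c * norm x"
    by (simp add: scaleC_vec_def norm_vec_def norm_scaleC L2_set_right_distrib)
qed (auto simp: scaleC_vec_def scaleC_add_right scaleC_add_left scaleC_scaleC scaleC_of_real
      vec_eq_iff)

end

text \<open>Banach spaces are represented as complete complex-linear subspaces of a complex normed
  space, and operators between them as functions restricted to these carrier sets.\<close>

definition complex_subspace :: "'a::complex_normed_vector set \<Rightarrow> bool" where
  "complex_subspace X \<longleftrightarrow>
     0 \<in> X \<and> (\<forall>x\<in>X. \<forall>y\<in>X. x + y \<in> X) \<and> (\<forall>c. \<forall>x\<in>X. c *\<^sub>C x \<in> X)"

definition complex_banach :: "'a::complex_normed_vector set \<Rightarrow> bool" where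
  "complex_banach X \<longleftrightarrow> complex_subspace X \<and> complete X"

definition bounded_operator ::
    "'a::complex_normed_vector set \<Rightarrow> 'b::complex_normed_vector set \<Rightarrow> ('a \<Rightarrow> 'b) \<Rightarrow> bool" where
  "bounded_operator X Y T \<longleftrightarrow>
     T \<in> X \<rightarrow> Y \<and>
     (\<forall>x\<in>X. \<forall>y\<in>X. T (x + y) = T x + T y) \<and>
     (\<forall>c. \<forall>x\<in>X. T (c *\<^sub>C x) = c *\<^sub>C T x) \<and>
     (\<exists>K. \<forall>x\<in>X. norm (T x) \<le> K * norm x)"

definition invertible_operator ::
    "'a::complex_normed_vector set \<Rightarrow> 'b::complex_normed_vector set \<Rightarrow> ('a \<Rightarrow> 'b) \<Rightarrow> bool" where
  "invertible_operator X Y T \<longleftrightarrow>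
     bounded_operator X Y T \<and>
     (\<exists>S. bounded_operator Y X S \<and> (\<forall>x\<in>X. S (T x) = x) \<and> (\<forall>y\<in>Y. T (S y) = y))"

text \<open>HOL cannot quantify existentially over types, so the types in which the Banach spaces
  \<open>X\<^sub>0\<close> and \<open>Y\<^sub>0\<close> live are explicit arguments of the following notion.  For the choice
  \<open>'u = 'y\<close>, \<open>'v = 'x\<close> this is no restriction: by a theorem of Bart and Tsekanovskii, if
  \<open>T\<close> and \<open>S\<close> are equivalent after extension at all, then \<open>X\<^sub>0 = Y\<close> and \<open>Y\<^sub>0 = X\<close> is
  possible.\<close>

definition equivalent_after_extension ::
    "'u::complex_normed_vector itself \<Rightarrow> 'v::complex_normed_vector itself \<Rightarrow>
     'x::complex_normed_vector set \<Rightarrow> 'x'::complex_normed_vector set \<Rightarrow> ('x \<Rightarrow> 'x') \<Rightarrow>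
     'y::complex_normed_vector set \<Rightarrow> 'y'::complex_normed_vector set \<Rightarrow> ('y \<Rightarrow> 'y') \<Rightarrow> bool" where
  "equivalent_after_extension _ _ X X' T Y Y' S \<longleftrightarrow>
     complex_banach X \<and> complex_banach X' \<and> bounded_operator X X' T \<and>
     complex_banach Y \<and> complex_banach Y' \<and> bounded_operator Y Y' S \<and>
     (\<exists>(X\<^sub>0 :: 'u set) (Y\<^sub>0 :: 'v set) E F.
        complex_banach X\<^sub>0 \<and> complex_banach Y\<^sub>0 \<and>
        invertible_operator (Y' \<times> Y\<^sub>0) (X' \<times> X\<^sub>0) E \<and>
        invertible_operator (X \<times> X\<^sub>0) (Y \<times> Y\<^sub>0) F \<and>
        (\<forall>p \<in> X \<times> X\<^sub>0. map_prod T id p = E (map_prod S id (F p))))"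


section \<open>The space \<open>L\<^sup>2\<close> of the unit circle\<close>

definition circle :: "complex measure" where
  "circle = distr (uniform_measure lborel {0..<2 * pi}) (restrict_space borel (sphere 0 1)) cis"

definition square_integrable :: "(complex \<Rightarrow> complex) \<Rightarrow> bool" where
  "square_integrable f \<longleftrightarrow> f \<in> borel_measurable circle \<and> integrable circle (\<lambda>z. (cmod (f z))\<^sup>2)"

lemma square_integrable_zero: "square_integrable (\<lambda>_. 0)"
  by (simp add: square_integrable_def)

lemma square_integrable_add:
  assumes "square_integrable f" "square_integrable g"
  shows "square_integrable (\<lambda>z. f z + g z)"
proof -
  have [measurable]: "f \<in> borel_measurable circle" "g \<in> borel_measurable circle"
    using assms by (auto simp: square_integrable_def)
  have "integrable circle (\<lambda>z. (cmod (f z + g z))\<^sup>2)"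
  proof (rule Bochner_Integration.integrable_bound)
    show "integrable circle (\<lambda>z. 2 * (cmod (f z))\<^sup>2 + 2 * (cmod (g z))\<^sup>2)"
      using assms by (auto simp: square_integrable_def)
    have "(cmod (f z + g z))\<^sup>2 \<le> 2 * (cmod (f z))\<^sup>2 + 2 * (cmod (g z))\<^sup>2" for z
    proof -
      have "(cmod (f z + g z))\<^sup>2 \<le> (cmod (f z) + cmod (g z))\<^sup>2"
        by (intro power_mono norm_triangle_ineq) auto
      also have "\<dots> \<le> 2 * (cmod (f z))\<^sup>2 + 2 * (cmod (g z))\<^sup>2"
        using sum_squares_bound[of "cmod (f z)" "cmod (g z)"]
        by (simp add: power2_sum)
      finally show ?thesis .
    qed
    then show "AE z in circle. norm ((cmod (f z + g z))\<^sup>2)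
        \<le> norm (2 * (cmod (f z))\<^sup>2 + 2 * (cmod (g z))\<^sup>2)"
      by simp
  qed measurable
  then show ?thesis by (simp add: square_integrable_def)
qed

lemma integrable_mult_cnj:
  assumes "square_integrable f" "square_integrable g"
  shows "integrable circle (\<lambda>z. f z * cnj (g z))"
proof (rule Bochner_Integration.integrable_bound)
  have [measurable]: "f \<in> borel_measurable circle" "g \<in> borel_measurable circle"
    using assms by (auto simp: square_integrable_def)
  show "integrable circle (\<lambda>z. (cmod (f z))\<^sup>2 + (cmod (g z))\<^sup>2)"
    using assms by (auto simp: square_integrable_def)
  have cnj_meas: "cnj \<in> borel_measurable borel"
    by (intro borel_measurable_continuous_onI continuous_intros)
  show "(\<lambda>z. f z * cnj (g z)) \<in> borel_measurable circle"
    using measurable_compose[OF \<open>g \<in> borel_measurable circle\<close> cnj_meas] by measurable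
  have "cmod (f z) * cmod (g z) \<le> (cmod (f z))\<^sup>2 + (cmod (g z))\<^sup>2" for z
    using sum_squares_bound[of "cmod (f z)" "cmod (g z)"]
      mult_nonneg_nonneg[OF norm_ge_zero[of "f z"] norm_ge_zero[of "g z"]] by linarith
  then show "AE z in circle. norm (f z * cnj (g z)) \<le> norm ((cmod (f z))\<^sup>2 + (cmod (g z))\<^sup>2)"
    by (simp add: norm_mult)
qed

definition Linf :: "(complex \<Rightarrow> complex) set" where
  "Linf = {f \<in> borel_measurable circle. \<exists>C. AE z in circle. cmod (f z) \<le> C}"

lemma square_integrable_mult:
  assumes "g \<in> Linf" "square_integrable f"
  shows "square_integrable (\<lambda>z. g z * f z)"
proof -
  have [measurable]: "f \<in> borel_measurable circle" "g \<in> borel_measurable circle"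
    using assms by (auto simp: square_integrable_def Linf_def)
  obtain C where C: "AE z in circle. cmod (g z) \<le> C"
    using assms by (auto simp: Linf_def)
  have "integrable circle (\<lambda>z. (cmod (g z * f z))\<^sup>2)"
  proof (rule Bochner_Integration.integrable_bound)
    show "integrable circle (\<lambda>z. C\<^sup>2 * (cmod (f z))\<^sup>2)"
      using assms by (auto simp: square_integrable_def)
    show "AE z in circle. norm ((cmod (g z * f z))\<^sup>2) \<le> norm (C\<^sup>2 * (cmod (f z))\<^sup>2)"
      using C by eventually_elim
        (simp add: norm_mult power_mult_distrib mult_right_mono power_mono)
  qed measurable
  then show ?thesis by (simp add: square_integrable_def)
qed

lemma Linf_const: "(\<lambda>_. c) \<in> Linf"
  by (auto simp: Linf_def)

definition eq_L2 :: "(complex \<Rightarrow> complex) \<Rightarrow> (complex \<Rightarrow> complex) \<Rightarrow> bool" where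
  "eq_L2 f g \<longleftrightarrow> square_integrable f \<and> square_integrable g \<and> (AE z in circle. f z = g z)"

quotient_type L2 = "complex \<Rightarrow> complex" / partial: eq_L2
proof (rule part_equivpI)
  show "\<exists>f. eq_L2 f f"
    by (rule exI[of _ "\<lambda>_. 0"]) (simp add: eq_L2_def square_integrable_zero)
  show "symp eq_L2"
    by (rule sympI) (auto simp: eq_L2_def)
  show "transp eq_L2"
  proof (rule transpI)
    fix f g h assume fg: "eq_L2 f g" and gh: "eq_L2 g h"
    have "AE z in circle. f z = g z" "AE z in circle. g z = h z"
      using fg gh by (auto simp: eq_L2_def)
    then have "AE z in circle. f z = h z" by eventually_elim simp
    then show "eq_L2 f h" using fg gh by (auto simp: eq_L2_def)
  qed
qed

lift_definition cinner :: "L2 \<Rightarrow> L2 \<Rightarrow> complex" is "\<lambda>f g. LINT z|circle. f z * cnj (g z)"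
proof -
  fix f f' g g' assume "eq_L2 f f'" "eq_L2 g g'"
  then have A: "AE z in circle. f z = f' z" "AE z in circle. g z = g' z"
    and I: "integrable circle (\<lambda>z. f z * cnj (g z))" "integrable circle (\<lambda>z. f' z * cnj (g' z))"
    by (auto simp: eq_L2_def integrable_mult_cnj)
  from A have "AE z in circle. f z * cnj (g z) = f' z * cnj (g' z)"
    by eventually_elim simp
  then show "(LINT z|circle. f z * cnj (g z)) = (LINT z|circle. f' z * cnj (g' z))"
    using I by (intro integral_cong_AE) auto
qed

text \<open>Multiplication by an essentially bounded function; the value for other \<open>g\<close> is irrelevant.\<close>

lift_definition mult_L2 :: "(complex \<Rightarrow> complex) \<Rightarrow> L2 \<Rightarrow> L2"
  is "\<lambda>g f. if g \<in> Linf then (\<lambda>z. g z * f z) else (\<lambda>_. 0)"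
proof -
  fix g f f' assume "eq_L2 f f'"
  then show "eq_L2 (if g \<in> Linf then (\<lambda>z. g z * f z) else (\<lambda>_. 0))
      (if g \<in> Linf then (\<lambda>z. g z * f' z) else (\<lambda>_. 0))"
    by (auto simp: eq_L2_def square_integrable_mult square_integrable_zero)
qed

instantiation L2 :: real_vector
begin

lift_definition zero_L2 :: L2 is "\<lambda>_. 0"
  by (simp add: eq_L2_def square_integrable_zero)

lift_definition plus_L2 :: "L2 \<Rightarrow> L2 \<Rightarrow> L2" is "\<lambda>f g z. f z + g z"
  by (auto simp: eq_L2_def square_integrable_add)

definition scaleR_L2 :: "real \<Rightarrow> L2 \<Rightarrow> L2" where
  "scaleR_L2 r f = mult_L2 (\<lambda>_. of_real r) f"

definition uminus_L2 :: "L2 \<Rightarrow> L2" where "uminus_L2 f = mult_L2 (\<lambda>_. -1) f"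

definition minus_L2 :: "L2 \<Rightarrow> L2 \<Rightarrow> L2" where "minus_L2 f g = f + - (g::L2)"

instance
proof
  fix a b c :: L2 and r s :: real
  show "a + b + c = a + (b + c)"
    by transfer (auto simp: eq_L2_def square_integrable_add add.assoc)
  show "a + b = b + a"
    by transfer (auto simp: eq_L2_def square_integrable_add add.commute)
  show "0 + a = a"
    by transfer (auto simp: eq_L2_def)
  show "- a + a = 0"
    unfolding uminus_L2_def
    by transfer (use square_integrable_mult[OF Linf_const[of "-1"]] in
      \<open>auto simp: eq_L2_def Linf_const square_integrable_zero\<close>)
  show "a - b = a + - b" by (simp add: minus_L2_def)
  show "r *\<^sub>R (a + b) = r *\<^sub>R a + r *\<^sub>R b"
    unfolding scaleR_L2_def
    by transfer (auto simp: eq_L2_def Linf_const distrib_left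
        intro!: square_integrable_add square_integrable_mult simp flip: distrib_left)
  show "(r + s) *\<^sub>R a = r *\<^sub>R a + s *\<^sub>R a"
    unfolding scaleR_L2_def
    by transfer (auto simp: eq_L2_def Linf_const distrib_right
        intro!: square_integrable_add square_integrable_mult)
  show "r *\<^sub>R s *\<^sub>R a = (r * s) *\<^sub>R a"
    unfolding scaleR_L2_def
    by transfer (auto simp: eq_L2_def Linf_const mult.assoc intro!: square_integrable_mult)
  show "1 *\<^sub>R a = a"
    unfolding scaleR_L2_def by transfer (auto simp: eq_L2_def Linf_const)
qed

end

instantiation L2 :: real_inner
begin

definition inner_L2 :: "L2 \<Rightarrow> L2 \<Rightarrow> real" where "inner_L2 f g = Re (cinner f g)"

definition norm_L2 :: "L2 \<Rightarrow> real" where "norm_L2 f = sqrt (inner f f)"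

definition sgn_L2 :: "L2 \<Rightarrow> L2" where "sgn_L2 f = f /\<^sub>R norm f"

definition dist_L2 :: "L2 \<Rightarrow> L2 \<Rightarrow> real" where "dist_L2 f g = norm (f - g)"

definition uniformity_L2 :: "(L2 \<times> L2) filter" where
  "uniformity_L2 = (INF e\<in>{0<..}. principal {(x, y). dist x (y::L2) < e})"

definition open_L2 :: "L2 set \<Rightarrow> bool" where
  "open_L2 U \<longleftrightarrow> (\<forall>x\<in>U. eventually (\<lambda>(x', y). x' = x \<longrightarrow> y \<in> U) uniformity)"

instance
proof
  fix a b f g h :: L2 and r :: real
  show "sgn a = a /\<^sub>R norm a" by (simp add: sgn_L2_def)
  show "dist a b = norm (a - b)" by (simp add: dist_L2_def)
  show "uniformity = (INF e\<in>{0<..}. principal {(x::L2, y). dist x y < e})"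
    by (simp add: uniformity_L2_def)
  show "open U \<longleftrightarrow> (\<forall>x\<in>U. eventually (\<lambda>(x', y). x' = x \<longrightarrow> y \<in> U) uniformity)"
    for U :: "L2 set"
    by (simp add: open_L2_def)
  show "inner f g = inner g f"
    unfolding inner_L2_def
  proof transfer
    fix f g assume "eq_L2 f f" "eq_L2 g g"
    have "(LINT z|circle. g z * cnj (f z)) = (LINT z|circle. cnj (f z * cnj (g z)))"
      by (simp add: mult.commute)
    also have "\<dots> = cnj (LINT z|circle. f z * cnj (g z))"
      by (simp only: Bochner_Integration.integral_cnj)
    finally show "Re (LINT z|circle. f z * cnj (g z)) = Re (LINT z|circle. g z * cnj (f z))"
      by simp
  qed
  show "inner (f + g) h = inner f h + inner g h"
    unfolding inner_L2_def
    by transfer (simp add: distrib_right eq_L2_def integrable_mult_cnj)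
  show "inner (r *\<^sub>R f) g = r * inner f g"
    unfolding inner_L2_def scaleR_L2_def
    by transfer (simp add: Linf_const eq_L2_def mult.assoc)
  have *: "inner f f = (LINT z|circle. (cmod (rep_L2 f z))\<^sup>2)"
  proof -
    have "cinner f f = (LINT z|circle. rep_L2 f z * cnj (rep_L2 f z))"
      by (simp add: cinner.rep_eq)
    also have "\<dots> = of_real (LINT z|circle. (cmod (rep_L2 f z))\<^sup>2)"
      by (simp add: complex_norm_square [symmetric] flip: of_real_power)
    finally show ?thesis by (simp add: inner_L2_def)
  qed
  show "0 \<le> inner f f" unfolding * by (rule integral_nonneg_AE) simp
  show "inner f f = 0 \<longleftrightarrow> f = 0"
  proof -
    have rep: "eq_L2 (rep_L2 f) (rep_L2 f)"
      using Quotient_rep_reflp[OF Quotient_L2] .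
    then have "integrable circle (\<lambda>z. (cmod (rep_L2 f z))\<^sup>2)"
      by (simp add: eq_L2_def square_integrable_def)
    then have "inner f f = 0 \<longleftrightarrow> (AE z in circle. (cmod (rep_L2 f z))\<^sup>2 = 0)"
      unfolding * by (intro integral_nonneg_eq_0_iff_AE) auto
    also have "\<dots> \<longleftrightarrow> eq_L2 (rep_L2 f) (\<lambda>_. 0)"
      using rep by (auto simp: eq_L2_def square_integrable_zero)
    also have "\<dots> \<longleftrightarrow> abs_L2 (rep_L2 f) = 0"
      unfolding zero_L2_def using rep Quotient_rel[OF Quotient_L2, of "rep_L2 f" "\<lambda>_. 0"]
      by (auto simp: eq_L2_def square_integrable_zero)
    also have "\<dots> \<longleftrightarrow> f = 0"
      by (simp add: Quotient_abs_rep[OF Quotient_L2])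
    finally show ?thesis .
  qed
  show "norm f = sqrt (inner f f)" by (simp add: norm_L2_def)
qed

end

instantiation L2 :: complex_normed_vector
begin

definition scaleC_L2 :: "complex \<Rightarrow> L2 \<Rightarrow> L2" where
  "scaleC_L2 c f = mult_L2 (\<lambda>_. c) f"

instance
proof
  fix c d :: complex and r :: real and f g :: L2
  show "c *\<^sub>C (f + g) = c *\<^sub>C f + c *\<^sub>C g"
    unfolding scaleC_L2_def
    by transfer (auto simp: eq_L2_def Linf_const distrib_left
        intro!: square_integrable_add square_integrable_mult simp flip: distrib_left)
  show "(c + d) *\<^sub>C f = c *\<^sub>C f + d *\<^sub>C f"
    unfolding scaleC_L2_def
    by transfer (auto simp: eq_L2_def Linf_const distrib_right
        intro!: square_integrable_add square_integrable_mult)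
  show "c *\<^sub>C d *\<^sub>C f = (c * d) *\<^sub>C f"
    unfolding scaleC_L2_def
    by transfer (auto simp: eq_L2_def Linf_const mult.assoc intro!: square_integrable_mult)
  show "complex_of_real r *\<^sub>C f = r *\<^sub>R f"
    by (simp add: scaleC_L2_def scaleR_L2_def)
  have "cinner (c *\<^sub>C f) (c *\<^sub>C f) = of_real ((cmod c)\<^sup>2) * cinner f f"
    unfolding scaleC_L2_def
  proof transfer
    fix c f
    have "(LINT z|circle. c * f z * cnj (c * f z)) = (LINT z|circle. (c * cnj c) * (f z * cnj (f z)))"
      by (simp add: algebra_simps)
    also have "\<dots> = (c * cnj c) * (LINT z|circle. f z * cnj (f z))"
      by (rule integral_mult_right_zero)
    finally show "(LINT z|circle. (if (\<lambda>_. c) \<in> Linf then \<lambda>z. c * f z else (\<lambda>_. 0)) z *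
        cnj ((if (\<lambda>_. c) \<in> Linf then \<lambda>z. c * f z else (\<lambda>_. 0)) z)) =
        complex_of_real ((cmod c)\<^sup>2) * (LINT z|circle. f z * cnj (f z))"
      by (simp only: Linf_const if_True complex_norm_square)
  qed
  then have "inner (c *\<^sub>C f) (c *\<^sub>C f) = (cmod c)\<^sup>2 * inner f f"
    by (simp only: inner_L2_def) (simp flip: of_real_power)
  then show "norm (c *\<^sub>C f) = cmod c * norm f"
    by (simp add: norm_L2_def real_sqrt_mult)
qed

end

definition orth_proj :: "L2 set \<Rightarrow> L2 \<Rightarrow> L2" where
  "orth_proj M f = (THE h. h \<in> M \<and> (\<forall>m\<in>M. cinner (f - h) m = 0))"


section \<open>Hardy spaces, model spaces and Toeplitz operators\<close>

text \<open>The Hardy spaces of the disc are identified, as usual, with the spaces of their boundary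
  functions, that is, with the functions on the circle without negative Fourier coefficients.\<close>

definition fourier_coeff :: "(complex \<Rightarrow> complex) \<Rightarrow> int \<Rightarrow> complex" where
  "fourier_coeff f n = (LINT z|circle. f z * z powi (- n))"

definition H2 :: "L2 set" where
  "H2 = {abs_L2 f | f. square_integrable f \<and> (\<forall>n<0. fourier_coeff f n = 0)}"

definition Hinf :: "(complex \<Rightarrow> complex) set" where
  "Hinf = {f \<in> Linf. \<forall>n<0. fourier_coeff f n = 0}"

definition unimodular :: "(complex \<Rightarrow> complex) \<Rightarrow> bool" where
  "unimodular f \<longleftrightarrow> (AE z in circle. cmod (f z) = 1)"

definition inner_function :: "(complex \<Rightarrow> complex) \<Rightarrow> bool" where
  "inner_function \<theta> \<longleftrightarrow> \<theta> \<in> Hinf \<and> unimodular \<theta>"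

definition model_space :: "(complex \<Rightarrow> complex) \<Rightarrow> L2 set" where
  "model_space \<theta> = {f \<in> H2. \<forall>h\<in>H2. cinner f (mult_L2 \<theta> h) = 0}"

text \<open>The orthogonal sum \<open>\<phi> K\<^sub>\<theta> \<oplus> \<psi> K\<^sub>\<theta>\<close>; orthogonality of the summands is a separate hypothesis.\<close>

definition dual_band_space ::
    "(complex \<Rightarrow> complex) \<Rightarrow> (complex \<Rightarrow> complex) \<Rightarrow> (complex \<Rightarrow> complex) \<Rightarrow> L2 set" where
  "dual_band_space \<theta> \<phi> \<psi> =
     {mult_L2 \<phi> f + mult_L2 \<psi> h | f h. f \<in> model_space \<theta> \<and> h \<in> model_space \<theta>}"

definition compressed_mult :: "L2 set \<Rightarrow> (complex \<Rightarrow> complex) \<Rightarrow> L2 \<Rightarrow> L2" where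
  "compressed_mult M g f = orth_proj M (mult_L2 g f)"

definition H2_vec :: "(L2 ^ 'n) set" where
  "H2_vec = {f. \<forall>i. f $ i \<in> H2}"

definition toeplitz :: "(complex \<Rightarrow> complex ^ 'n ^ 'n) \<Rightarrow> L2 ^ 'n \<Rightarrow> L2 ^ 'n" where
  "toeplitz G f = (\<chi> i. orth_proj H2 (\<Sum>j\<in>UNIV. mult_L2 (\<lambda>z. G z $ i $ j) (f $ j)))"

definition dual_band_symbol ::
    "(complex \<Rightarrow> complex) \<Rightarrow> (complex \<Rightarrow> complex) \<Rightarrow> (complex \<Rightarrow> complex) \<Rightarrow>
     (complex \<Rightarrow> complex) \<Rightarrow> complex \<Rightarrow> complex ^ 4 ^ 4" where
  "dual_band_symbol \<theta> \<phi> \<psi> g z = vector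
     [vector [cnj (\<theta> z),                0,                         0,   0],
      vector [0,                        cnj (\<theta> z),                 0,   0],
      vector [g z,                      g z * cnj (\<phi> z) * \<psi> z,    \<theta> z, 0],
      vector [g z * \<phi> z * cnj (\<psi> z),   g z,                       0,   \<theta> z]]"

end

theory Submission
  imports Defs
begin

text \<open>Write \<open>P\<close> for the projection onto \<open>H2\<close>, \<open>K\<close> for the model space and \<open>Q = P - \<theta> P (cnj \<theta>)\<close> for
  the projection onto \<open>K\<close>.  Since \<open>\<phi>\<close> and \<open>\<psi>\<close> are unimodular and \<open>\<phi> K\<close>, \<open>\<psi> K\<close> are orthogonal,
  \<open>(f, h) \<mapsto> \<phi> f + \<psi> h\<close> identifies \<open>K \<times> K\<close> with the dual-band space, and turns the compression
  of \<open>g\<close> into \<open>u \<mapsto> Q (A u)\<close>, where \<open>A\<close> is the lower left \<open>2 \<times> 2\<close> block of the symbol.  The Toeplitz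
  operator maps \<open>(u, v)\<close> to \<open>(P (cnj \<theta> u), P (A u) + \<theta> v)\<close>.  Decompose \<open>u = k + \<theta> w\<close> along
  \<open>H2 = K \<oplus> \<theta> H2\<close>, so that the first component is \<open>w\<close>, and replace \<open>v\<close> by \<open>v - P (cnj \<theta> A u)\<close>, which
  changes the second component to \<open>Q (A k) + Q (A \<theta> w) + \<theta> v\<close>.  Subtracting the term that depends on
  \<open>w\<close> leaves the direct sum of \<open>k \<mapsto> Q (A k)\<close> and the identity in \<open>(w, v)\<close>.\<close>

section \<open>Elementary properties of \<open>L2\<close>\<close>

lemma space_circle [simp]: "space circle = sphere 0 1"
  by (simp add: circle_def)

lemma sets_circle [measurable_cong]: "sets circle = sets (restrict_space borel (sphere 0 1))"
  by (simp add: circle_def)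

lemma measurable_cis: "cis \<in> measurable lborel (restrict_space borel (sphere 0 1))"
  by (intro measurable_restrict_space2) (auto intro!: borel_measurable_continuous_onI continuous_intros)

lemma emeasure_circle: "emeasure circle (space circle) = 1"
proof -
  have m: "cis \<in> measurable (uniform_measure lborel {0..<2 * pi}) (restrict_space borel (sphere 0 1))"
    using measurable_cis by simp
  show ?thesis
    unfolding circle_def
  proof (subst emeasure_distr[OF m])
    have "cis -` sphere 0 1 = UNIV" by auto
    then show "emeasure (uniform_measure lborel {0..<2 * pi})
        (cis -` space (distr (uniform_measure lborel {0..<2 * pi})
          (restrict_space borel (sphere 0 1)) cis) \<inter> space (uniform_measure lborel {0..<2 * pi})) = 1"
      by (simp add: emeasure_uniform_measure ennreal_divide_self)
  next
    show "space (distr (uniform_measure lborel {0..<2 * pi})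
        (restrict_space borel (sphere 0 1)) cis) \<in> sets (restrict_space borel (sphere 0 1))"
      using sets.top[of "restrict_space borel (sphere 0 1 :: complex set)"]
      by (simp del: sets.top)
  qed
qed

interpretation circle: finite_measure circle
  by (rule finite_measureI) (simp add: emeasure_circle[simplified])

section \<open>Computing with representatives of classes in \<open>L2\<close>\<close>

lemma L2_cases:
  obtains f where "square_integrable f" "x = abs_L2 f"
  by (metis Quotient_L2 Quotient_abs_rep Quotient_rep_reflp eq_L2_def)

lemma abs_L2_eq_iff:
  "square_integrable f \<Longrightarrow> square_integrable g \<Longrightarrow> abs_L2 f = abs_L2 g \<longleftrightarrow> (AE z in circle. f z = g z)"
  using Quotient_rel[OF Quotient_L2, of f g] by (auto simp: eq_L2_def)

lemma eq_L2_refl [simp]: "eq_L2 f f \<longleftrightarrow> square_integrable f"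
  by (simp add: eq_L2_def)

lemma cinner_abs_L2:
  "square_integrable f \<Longrightarrow> square_integrable g \<Longrightarrow>
    cinner (abs_L2 f) (abs_L2 g) = (LINT z|circle. f z * cnj (g z))"
  by (simp add: cinner.abs_eq)

lemma mult_abs_L2:
  "g \<in> Linf \<Longrightarrow> square_integrable f \<Longrightarrow> mult_L2 g (abs_L2 f) = abs_L2 (\<lambda>z. g z * f z)"
  by (simp add: mult_L2.abs_eq)

lemma plus_abs_L2:
  "square_integrable f \<Longrightarrow> square_integrable g \<Longrightarrow>
    abs_L2 f + abs_L2 g = abs_L2 (\<lambda>z. f z + g z)"
  by (simp add: plus_L2.abs_eq)

lemma minus_abs_L2:
  "square_integrable f \<Longrightarrow> square_integrable g \<Longrightarrow>
    abs_L2 f - abs_L2 g = abs_L2 (\<lambda>z. f z - g z)"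
  using square_integrable_mult[OF Linf_const[of "-1"], of g]
  by (simp add: minus_L2_def uminus_L2_def mult_abs_L2 plus_abs_L2 Linf_const)

lemma square_integrable_diff:
  "square_integrable f \<Longrightarrow> square_integrable g \<Longrightarrow> square_integrable (\<lambda>z. f z - g z)"
  using square_integrable_add[of f "\<lambda>z. -1 * g z"] square_integrable_mult[OF Linf_const[of "-1"], of g]
  by simp

lemma norm_abs_L2:
  assumes "square_integrable f"
  shows "(norm (abs_L2 f))\<^sup>2 = (LINT z|circle. (cmod (f z))\<^sup>2)"
proof -
  have "cinner (abs_L2 f) (abs_L2 f) = of_real (LINT z|circle. (cmod (f z))\<^sup>2)"
    by (simp add: cinner_abs_L2 assms complex_norm_square [symmetric] flip: of_real_power)
  then show ?thesis
    by (simp add: power2_norm_eq_inner inner_L2_def)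
qed

section \<open>Multiplication by bounded functions\<close>

lemma Linf_mult: "f \<in> Linf \<Longrightarrow> g \<in> Linf \<Longrightarrow> (\<lambda>z. f z * g z) \<in> Linf"
proof -
  assume f: "f \<in> Linf" and g: "g \<in> Linf"
  then obtain C D where "AE z in circle. cmod (f z) \<le> C" "AE z in circle. cmod (g z) \<le> D"
    by (auto simp: Linf_def)
  then have "AE z in circle. cmod (f z * g z) \<le> C * D"
  proof eventually_elim
    case (elim z)
    have "0 \<le> C" using order_trans[OF norm_ge_zero elim(1)] .
    then show ?case using elim by (simp add: norm_mult mult_mono)
  qed
  then show ?thesis using f g by (auto simp: Linf_def)
qed

lemma Linf_cnj: "f \<in> Linf \<Longrightarrow> (\<lambda>z. cnj (f z)) \<in> Linf"
  using measurable_compose[of f circle borel cnj borel]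
    borel_measurable_continuous_onI[of cnj, OF continuous_on_cnj[OF continuous_on_id]]
  by (auto simp: Linf_def)

lemma mult_L2_mult:
  assumes "f \<in> Linf" "g \<in> Linf"
  shows "mult_L2 (\<lambda>z. f z * g z) x = mult_L2 f (mult_L2 g x)"
  by (cases x rule: L2_cases)
    (simp add: mult_abs_L2 Linf_mult assms square_integrable_mult mult.assoc)

lemma mult_L2_commute:
  assumes "f \<in> Linf" "g \<in> Linf"
  shows "mult_L2 f (mult_L2 g x) = mult_L2 g (mult_L2 f x)"
  using mult_L2_mult[OF assms] mult_L2_mult[OF assms(2,1)] by (simp add: mult.commute)

lemma mult_L2_add: "f \<in> Linf \<Longrightarrow> mult_L2 f (x + y) = mult_L2 f x + mult_L2 f y"
  by (cases x rule: L2_cases; cases y rule: L2_cases)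
    (simp add: mult_abs_L2 plus_abs_L2 square_integrable_mult square_integrable_add distrib_left)

lemma mult_L2_scaleC: "f \<in> Linf \<Longrightarrow> mult_L2 f (c *\<^sub>C x) = c *\<^sub>C mult_L2 f x"
  by (simp add: scaleC_L2_def Linf_const mult_L2_commute)

lemma mult_L2_zero_left [simp]: "mult_L2 (\<lambda>z. 0) x = 0"
  by (cases x rule: L2_cases) (simp add: mult_abs_L2 Linf_const zero_L2_def)

lemma mult_L2_cong:
  assumes "f \<in> Linf" "g \<in> Linf" "AE z in circle. f z = g z"
  shows "mult_L2 f x = mult_L2 g x"
  using assms by (cases x rule: L2_cases)
    (auto simp: mult_abs_L2 abs_L2_eq_iff square_integrable_mult)

lemma mult_L2_cnj_unimodular:
  assumes "f \<in> Linf" "unimodular f"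
  shows "mult_L2 (\<lambda>z. cnj (f z)) (mult_L2 f x) = x"
proof -
  have "mult_L2 (\<lambda>z. cnj (f z)) (mult_L2 f x) = mult_L2 (\<lambda>z. 1) x"
    unfolding mult_L2_mult[OF Linf_cnj[OF assms(1)] assms(1), symmetric]
  proof (rule mult_L2_cong)
    show "AE z in circle. cnj (f z) * f z = 1"
      using assms(2) unfolding unimodular_def
      by eventually_elim (metis complex_norm_square mult.commute of_real_1 one_power2)
  qed (intro Linf_mult Linf_cnj assms Linf_const)+
  also have "\<dots> = x"
    by (cases x rule: L2_cases) (simp add: mult_abs_L2 Linf_const)
  finally show ?thesis .
qed

section \<open>The complex inner product\<close>

lemma cinner_mult_L2_left:
  assumes "f \<in> Linf"
  shows "cinner (mult_L2 f x) y = cinner x (mult_L2 (\<lambda>z. cnj (f z)) y)"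
  by (cases x rule: L2_cases; cases y rule: L2_cases)
    (simp add: mult_abs_L2 cinner_abs_L2 assms Linf_cnj square_integrable_mult,
      simp add: mult_ac)

lemma cinner_commute: "cinner y x = cnj (cinner x y)"
  by (cases x rule: L2_cases; cases y rule: L2_cases)
    (simp add: cinner_abs_L2 mult.commute flip: Bochner_Integration.integral_cnj)

lemma cinner_add_left: "cinner (x + y) z = cinner x z + cinner y z"
  by (cases x rule: L2_cases; cases y rule: L2_cases; cases z rule: L2_cases)
    (simp add: cinner_abs_L2 plus_abs_L2 square_integrable_add distrib_right integrable_mult_cnj)

lemma cinner_add_right: "cinner z (x + y) = cinner z x + cinner z y"
  by (metis cinner_add_left cinner_commute complex_cnj_add)

lemma cinner_diff_left: "cinner (x - y) z = cinner x z - cinner y z"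
  by (metis add_diff_cancel diff_add_cancel cinner_add_left)

lemma cinner_scaleC_left: "cinner (c *\<^sub>C x) y = c * cinner x y"
  by (cases x rule: L2_cases; cases y rule: L2_cases)
    (simp add: scaleC_L2_def mult_abs_L2 cinner_abs_L2 Linf_const
      square_integrable_mult[OF Linf_const] mult.assoc)

lemma cinner_scaleC_right: "cinner x (c *\<^sub>C y) = cnj c * cinner x y"
  by (metis cinner_scaleC_left cinner_commute complex_cnj_mult)

lemma cinner_zero_left [simp]: "cinner 0 x = 0"
  by (metis add_cancel_left_right add_0 cinner_add_left)

lemma cinner_self_eq_0: "cinner x x = 0 \<longleftrightarrow> x = 0"
  by (metis inner_L2_def inner_eq_zero_iff zero_complex.sel(1) cinner_zero_left)

text \<open>Cauchy-Schwarz holds for the real inner product, which is the real part of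
  \<open>cinner\<close>. Rotating \<open>x\<close> by the unimodular scalar \<open>c\<close> makes
  \<open>cinner x y\<close> real and nonnegative, so that nothing is lost by taking real
  parts.\<close>

lemma norm_cinner_le: "cmod (cinner x y) \<le> norm x * norm y"
proof (cases "cinner x y = 0")
  case False
  define c where "c = cnj (cinner x y) / cmod (cinner x y)"
  have c: "cmod c = 1" using False by (simp add: c_def norm_divide)
  have "cinner (c *\<^sub>C x) y = cmod (cinner x y)"
    using False by (simp add: cinner_scaleC_left c_def complex_norm_square[symmetric]
        mult.commute power2_eq_square)
  then have "cmod (cinner x y) = inner (c *\<^sub>C x) y"
    by (simp add: inner_L2_def)
  also have "\<dots> \<le> norm (c *\<^sub>C x) * norm y" by (rule norm_cauchy_schwarz)
  finally show ?thesis by (simp add: norm_scaleC c)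
qed simp

lemma norm_mult_L2_le:
  assumes "f \<in> Linf"
  shows "\<exists>C. \<forall>x. norm (mult_L2 f x) \<le> C * norm x"
proof -
  obtain C where C: "AE z in circle. cmod (f z) \<le> C"
    using assms by (auto simp: Linf_def)
  \<comment> \<open>The absolute value secures nonnegativity of the constant, which the final step
    from squares to norms needs.\<close>
  then have C': "AE z in circle. cmod (f z) \<le> \<bar>C\<bar>" by eventually_elim simp
  have "norm (mult_L2 f x) \<le> \<bar>C\<bar> * norm x" for x
  proof (cases x rule: L2_cases)
    case (1 u)
    have "(norm (mult_L2 f x))\<^sup>2 = (LINT z|circle. (cmod (f z * u z))\<^sup>2)"
      using 1 assms by (simp add: mult_abs_L2 norm_abs_L2 square_integrable_mult)
    also have "\<dots> \<le> (LINT z|circle. \<bar>C\<bar>\<^sup>2 * (cmod (u z))\<^sup>2)"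
    proof (rule integral_mono_AE)
      show "AE z in circle. (cmod (f z * u z))\<^sup>2 \<le> \<bar>C\<bar>\<^sup>2 * (cmod (u z))\<^sup>2"
        using C' by eventually_elim
          (simp only: norm_mult power_mult_distrib mult_right_mono power_mono norm_ge_zero zero_le_power2)
    qed (use 1 square_integrable_mult[OF assms, of u] in \<open>auto simp: square_integrable_def\<close>)
    also have "\<dots> = (\<bar>C\<bar> * norm x)\<^sup>2"
      using 1 by (simp add: power_mult_distrib norm_abs_L2)
    finally show ?thesis by (rule power2_le_imp_le) simp
  qed
  then show ?thesis by blast
qed


section \<open>Completeness and orthogonal projections\<close>

text \<open>The form of the norm to which monotone convergence and Fatou's lemma apply.\<close>

lemma nn_integral_norm_abs_L2:
  assumes "square_integrable f"
  shows "(\<integral>\<^sup>+z. ennreal ((cmod (f z))\<^sup>2) \<partial>circle) = ennreal ((norm (abs_L2 f))\<^sup>2)"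
  unfolding norm_abs_L2[OF assms]
  by (rule nn_integral_eq_integral) (use assms in \<open>auto simp: square_integrable_def\<close>)

text \<open>The weights are chosen such that \<open>2 ^ k * \<bar>d\<bar>\<^sup>2\<close> is almost everywhere summable over the increments
  \<open>d\<close>, and \<open>\<bar>d\<bar> \<le> (1/2) ^ k + 2 ^ k * \<bar>d\<bar>\<^sup>2\<close> by AM-GM.\<close>

lemma square_integrable_AE_convergent:
  assumes f: "\<And>k. square_integrable (f k)"
    and le: "\<And>k. norm (abs_L2 (f (Suc k)) - abs_L2 (f k)) \<le> (1/2) ^ k"
  shows "AE z in circle. convergent (\<lambda>k. f k z)"
proof -
  let ?d = "\<lambda>k z. f (Suc k) z - f k z"
  have d: "square_integrable (?d k)" for k by (intro square_integrable_diff f)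
  have [measurable]: "?d k \<in> borel_measurable circle" for k
    using d[of k] by (simp add: square_integrable_def)
  have "(\<integral>\<^sup>+z. (\<Sum>k. ennreal (2 ^ k * (cmod (?d k z))\<^sup>2)) \<partial>circle) =
      (\<Sum>k. \<integral>\<^sup>+z. ennreal (2 ^ k * (cmod (?d k z))\<^sup>2) \<partial>circle)"
    by (rule nn_integral_suminf) measurable
  also have "\<dots> = (\<Sum>k. ennreal (2 ^ k * (norm (abs_L2 (?d k)))\<^sup>2))"
  proof (rule arg_cong[of _ _ suminf], rule ext)
    fix k
    have "(\<integral>\<^sup>+z. ennreal (2 ^ k * (cmod (?d k z))\<^sup>2) \<partial>circle) =
        (\<integral>\<^sup>+z. ennreal (2 ^ k) * ennreal ((cmod (?d k z))\<^sup>2) \<partial>circle)"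
      by (simp add: ennreal_mult)
    also have "\<dots> = ennreal (2 ^ k) * (\<integral>\<^sup>+z. ennreal ((cmod (?d k z))\<^sup>2) \<partial>circle)"
      by (rule nn_integral_cmult) measurable
    finally show "(\<integral>\<^sup>+z. ennreal (2 ^ k * (cmod (?d k z))\<^sup>2) \<partial>circle) =
        ennreal (2 ^ k * (norm (abs_L2 (?d k)))\<^sup>2)"
      by (simp add: nn_integral_norm_abs_L2[OF d] ennreal_mult)
  qed
  also have "\<dots> \<le> (\<Sum>k. ennreal ((1/2) ^ k))"
  proof (rule suminf_le[OF _ summableI summableI], rule ennreal_leI)
    fix k :: nat
    have "2 ^ k * (norm (abs_L2 (?d k)))\<^sup>2 \<le> 2 ^ k * ((1/2) ^ k)\<^sup>2"
      using le[of k] f by (intro mult_left_mono power_mono) (auto simp: minus_abs_L2)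
    also have "\<dots> = ((1/2::real) ^ k)"
      by (simp add: power_divide power2_eq_square)
    finally show "2 ^ k * (norm (abs_L2 (?d k)))\<^sup>2 \<le> (1/2) ^ k" .
  qed
  also have "\<dots> < \<infinity>"
    unfolding infinity_ennreal_def less_top[symmetric]
    by (rule ennreal_suminf_neq_top) (auto intro!: summable_geometric)
  finally have "(\<integral>\<^sup>+z. (\<Sum>k. ennreal (2 ^ k * (cmod (?d k z))\<^sup>2)) \<partial>circle) \<noteq> \<infinity>" by simp
  then have "AE z in circle. (\<Sum>k. ennreal (2 ^ k * (cmod (?d k z))\<^sup>2)) \<noteq> \<infinity>"
    by (intro nn_integral_PInf_AE) measurable
  then show ?thesis
  proof eventually_elim
    case (elim z)
    have s: "summable (\<lambda>k. 2 ^ k * (cmod (?d k z))\<^sup>2)"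
      using elim by (intro summable_suminf_not_top) auto
    have "summable (\<lambda>k. (1/2) ^ k + 2 ^ k * (cmod (?d k z))\<^sup>2)"
      by (intro summable_add s summable_geometric) simp
    then have "summable (\<lambda>k. ?d k z)"
    proof (rule summable_comparison_test'[of _ 0])
      fix k :: nat
      define t where "t = cmod (?d k z)"
      have "0 \<le> t" by (simp add: t_def)
      have "2 * 1 * (2 ^ k * t) \<le> 1\<^sup>2 + (2 ^ k * t)\<^sup>2" by (rule sum_squares_bound)
      then have "2 * t \<le> (1/2) ^ k + 2 ^ k * t\<^sup>2"
        by (simp add: power_divide power2_eq_square field_simps)
      then have "t \<le> (1/2) ^ k + 2 ^ k * t\<^sup>2" using \<open>0 \<le> t\<close> by linarith
      then show "norm (?d k z) \<le> (1/2) ^ k + 2 ^ k * (cmod (?d k z))\<^sup>2"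
        by (simp add: t_def)
    qed
    then have "convergent (\<lambda>n. (\<Sum>k<n. ?d k z) + f 0 z)"
      by (intro convergent_add convergent_const) (simp add: summable_iff_convergent)
    moreover have "(\<Sum>k<n. ?d k z) = f n z - f 0 z" for n
      by (rule sum_lessThan_telescope[of "\<lambda>k. f k z"])
    ultimately show ?case by simp
  qed
qed

lemma Cauchy_rapid_subseq:
  fixes X :: "nat \<Rightarrow> 'a::metric_space"
  assumes "Cauchy X"
  obtains r :: "nat \<Rightarrow> nat" where "strict_mono r"
    "\<And>k. dist (X (r (Suc k))) (X (r k)) \<le> (1/2) ^ k"
proof -
  have "\<exists>N. \<forall>m\<ge>N. \<forall>n\<ge>N. dist (X m) (X n) < (1/2) ^ k" for k :: nat
    using metric_CauchyD[OF assms, of "(1/2) ^ k"] by simp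
  then obtain N where N: "\<And>k m n. m \<ge> N k \<Longrightarrow> n \<ge> N k \<Longrightarrow> dist (X m) (X n) < (1/2) ^ k"
    by metis
  \<comment> \<open>The sum puts \<open>r k\<close> above \<open>N k\<close>, and the summand
    \<open>k\<close> makes \<open>r\<close> strictly increasing even where \<open>N\<close>
    vanishes.\<close>
  define r where "r k = k + (\<Sum>i\<le>k. N i)" for k
  have mono: "strict_mono r"
    by (rule strict_monoI_Suc) (simp add: r_def)
  have *: "r k \<ge> N k" for k
    using member_le_sum[of k "{..k}" N] by (simp add: r_def)
  have **: "r (Suc k) \<ge> N k" for k
    using *[of k] strict_monoD[OF mono, of k "Suc k"] by simp
  show ?thesis using mono by (rule that) (intro less_imp_le N * **)
qed

text \<open>Riesz-Fischer: a rapidly converging subsequence of representatives converges almost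
  everywhere, and Fatou's lemma along it bounds the distance of every late term of the full sequence
  to the pointwise limit.\<close>

instance L2 :: complete_space
proof
  fix X :: "nat \<Rightarrow> L2" assume X: "Cauchy X"
  have "\<exists>f. square_integrable f \<and> X n = abs_L2 f" for n
    by (cases "X n" rule: L2_cases) auto
  then obtain f where f: "\<And>n. square_integrable (f n)" "\<And>n. X n = abs_L2 (f n)" by metis
  obtain r where r: "strict_mono r" "\<And>k. dist (X (r (Suc k))) (X (r k)) \<le> (1/2) ^ k"
    using Cauchy_rapid_subseq[OF X] by blast
  \<comment> \<open>Where the subsequence diverges, \<open>lim\<close> is an unspecified value; this
    happens only on a null set.\<close>
  define F where "F z = lim (\<lambda>k. f (r k) z)" for z
  have [measurable]: "f n \<in> borel_measurable circle" for n
    using f(1)[of n] by (simp add: square_integrable_def)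
  have [measurable]: "F \<in> borel_measurable circle"
    unfolding F_def by measurable
  have AE: "AE z in circle. (\<lambda>k. f (r k) z) \<longlonglongrightarrow> F z"
    using square_integrable_AE_convergent[of "\<lambda>k. f (r k)", OF f(1)] r(2)
    by (simp add: f(2) dist_norm convergent_LIMSEQ_iff F_def)
  have bound: "(\<integral>\<^sup>+z. ennreal ((cmod (F z - f m z))\<^sup>2) \<partial>circle) \<le> ennreal (e\<^sup>2)"
    if N: "\<And>k. k \<ge> N \<Longrightarrow> dist (X k) (X m) < e" for e m N
  proof -
    have "(\<integral>\<^sup>+z. ennreal ((cmod (F z - f m z))\<^sup>2) \<partial>circle) =
        (\<integral>\<^sup>+z. liminf (\<lambda>k. ennreal ((cmod (f (r k) z - f m z))\<^sup>2)) \<partial>circle)"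
    proof (rule nn_integral_cong_AE)
      show "AE z in circle. ennreal ((cmod (F z - f m z))\<^sup>2) =
          liminf (\<lambda>k. ennreal ((cmod (f (r k) z - f m z))\<^sup>2))"
        using AE
      proof eventually_elim
        case (elim z)
        have "(\<lambda>k. ennreal ((cmod (f (r k) z - f m z))\<^sup>2)) \<longlonglongrightarrow> ennreal ((cmod (F z - f m z))\<^sup>2)"
          by (intro tendsto_intros elim)
        from lim_imp_Liminf[OF _ this] show ?case by simp
      qed
    qed
    also have "\<dots> \<le> liminf (\<lambda>k. \<integral>\<^sup>+z. ennreal ((cmod (f (r k) z - f m z))\<^sup>2) \<partial>circle)"
      by (rule nn_integral_liminf) measurable
    also have "\<dots> = liminf (\<lambda>k. ennreal ((dist (X (r k)) (X m))\<^sup>2))"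
      by (simp add: nn_integral_norm_abs_L2 square_integrable_diff f minus_abs_L2 dist_norm)
    also have "\<dots> \<le> liminf (\<lambda>k. ennreal (e\<^sup>2))"
    proof (rule Liminf_mono)
      show "\<forall>\<^sub>F k in sequentially. ennreal ((dist (X (r k)) (X m))\<^sup>2) \<le> ennreal (e\<^sup>2)"
        using eventually_ge_at_top[of N]
      proof eventually_elim
        case (elim k)
        then have "r k \<ge> N" using strict_mono_imp_increasing[OF r(1), of k] by simp
        then show ?case using N by (intro ennreal_leI power_mono) (auto intro: less_imp_le)
      qed
    qed
    also have "\<dots> = ennreal (e\<^sup>2)" by (simp add: Liminf_const)
    finally show ?thesis .
  qed
  have sq: "square_integrable (\<lambda>z. F z - f m z)"
    if N: "\<And>k. k \<ge> N \<Longrightarrow> dist (X k) (X m) < e" for e m N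
    unfolding square_integrable_def
  proof
    show "integrable circle (\<lambda>z. (cmod (F z - f m z))\<^sup>2)"
      by (rule integrableI_bounded) (use bound[OF N] in \<open>auto simp: less_top[symmetric] top_unique\<close>)
  qed measurable
  obtain N0 where "\<And>k m. k \<ge> N0 \<Longrightarrow> m \<ge> N0 \<Longrightarrow> dist (X k) (X m) < 1"
    using metric_CauchyD[OF X, of 1] by auto
  then have "square_integrable (\<lambda>z. (F z - f N0 z) + f N0 z)"
    by (intro square_integrable_add sq f) auto
  then have F: "square_integrable F" by simp
  have "X \<longlonglongrightarrow> abs_L2 F"
  proof (rule metric_LIMSEQ_I)
    fix e :: real assume "e > 0"
    then obtain N where N: "\<And>k m. k \<ge> N \<Longrightarrow> m \<ge> N \<Longrightarrow> dist (X k) (X m) < e/2"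
      using metric_CauchyD[OF X, of "e/2"] by auto
    have "dist (X m) (abs_L2 F) < e" if "m \<ge> N" for m
    proof -
      have "dist (X m) (abs_L2 F) = norm (abs_L2 (\<lambda>z. F z - f m z))"
        by (subst dist_commute) (simp add: dist_norm f F minus_abs_L2)
      then have "(dist (X m) (abs_L2 F))\<^sup>2 \<le> (e/2)\<^sup>2"
        using bound[of N m "e/2", OF N] that
          nn_integral_norm_abs_L2[OF square_integrable_diff[OF F f(1), of m]]
        by simp
      then have "dist (X m) (abs_L2 F) \<le> e/2"
        by (rule power2_le_imp_le) (use \<open>e > 0\<close> in simp)
      then show ?thesis using \<open>e > 0\<close> by simp
    qed
    then show "\<exists>N. \<forall>m\<ge>N. dist (X m) (abs_L2 F) < e" by blast
  qed
  then show "convergent X" by (rule convergentI)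
qed

text \<open>A sequence in \<open>V\<close> that minimizes the distance to \<open>x\<close> is Cauchy
  by the parallelogram law, because midpoints stay in \<open>V\<close> and are no closer to
  \<open>x\<close> than the infimum. Its limit is a nearest point, and a nearest point is the foot
  of the perpendicular.\<close>

lemma orthogonal_projection_exists:
  fixes V :: "'a::{real_inner, complete_space} set"
  assumes V: "subspace V" "closed V"
  shows "\<exists>v\<in>V. \<forall>w\<in>V. inner (x - v) w = 0"
proof -
  have ne: "V \<noteq> {}" using subspace_0[OF V(1)] by auto
  let ?d = "infdist x V"
  have "\<exists>v\<in>V. dist x v < ?d + inverse (real (Suc n))" for n
  proof -
    have "(INF v\<in>V. dist x v) < ?d + inverse (real (Suc n))"
      by (simp add: infdist_notempty[OF ne])
    then show ?thesis
      by (subst (asm) cINF_less_iff) (use ne in \<open>auto intro: bdd_belowI[of _ 0]\<close>)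
  qed
  then obtain u where u: "\<And>n. u n \<in> V" "\<And>n. dist x (u n) < ?d + inverse (real (Suc n))"
    by metis
  have lim: "(\<lambda>n. dist x (u n)) \<longlonglongrightarrow> ?d"
  proof (rule tendsto_sandwich[of "\<lambda>_. ?d" _ _ "\<lambda>n. ?d + inverse (real (Suc n))"])
    show "(\<lambda>n. ?d + inverse (real (Suc n))) \<longlonglongrightarrow> ?d"
      using tendsto_add[OF tendsto_const LIMSEQ_inverse_real_of_nat, of ?d] by simp
    show "\<forall>\<^sub>F n in sequentially. ?d \<le> dist x (u n)"
      using u(1) by (intro always_eventually allI infdist_le)
    show "\<forall>\<^sub>F n in sequentially. dist x (u n) \<le> ?d + inverse (real (Suc n))"
      using u(2) by (intro always_eventually allI less_imp_le)
  qed simp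
  have par: "(dist (u m) (u n))\<^sup>2 \<le> 2 * (dist x (u m))\<^sup>2 + 2 * (dist x (u n))\<^sup>2 - 4 * ?d\<^sup>2" for m n
  proof -
    have "(1/2) *\<^sub>R (u m + u n) \<in> V"
      by (intro subspace_scale subspace_add V u)
    then have "?d \<le> dist x ((1/2) *\<^sub>R (u m + u n))" by (rule infdist_le)
    then have "?d\<^sup>2 \<le> (norm (x - (1/2) *\<^sub>R (u m + u n)))\<^sup>2"
      by (intro power_mono) (auto simp: dist_norm infdist_nonneg)
    moreover have "4 * (norm (x - (1/2) *\<^sub>R (u m + u n)))\<^sup>2 + (norm (u m - u n))\<^sup>2 =
        2 * (norm (x - u m))\<^sup>2 + 2 * (norm (x - u n))\<^sup>2"
      unfolding power2_norm_eq_inner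
      by (simp add: algebra_simps inner_commute)
    ultimately show ?thesis by (simp add: dist_norm)
  qed
  have "Cauchy u"
  proof (rule metric_CauchyI)
    fix e :: real assume e: "e > 0"
    have "(\<lambda>n. (dist x (u n))\<^sup>2) \<longlonglongrightarrow> ?d\<^sup>2" by (intro tendsto_intros lim)
    then have "\<forall>\<^sub>F n in sequentially. (dist x (u n))\<^sup>2 < ?d\<^sup>2 + e\<^sup>2 / 4"
      using e by (intro order_tendstoD(2)) auto
    then obtain N where N: "\<And>n. n \<ge> N \<Longrightarrow> (dist x (u n))\<^sup>2 < ?d\<^sup>2 + e\<^sup>2 / 4"
      by (auto simp: eventually_sequentially)
    have "dist (u m) (u n) < e" if "m \<ge> N" "n \<ge> N" for m n
    proof (rule power_less_imp_less_base)
      show "(dist (u m) (u n))\<^sup>2 < e\<^sup>2"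
        using par[of m n] N[OF that(1)] N[OF that(2)] by linarith
    qed (use e in simp)
    then show "\<exists>M. \<forall>m\<ge>M. \<forall>n\<ge>M. dist (u m) (u n) < e" by blast
  qed
  then obtain v where v: "u \<longlonglongrightarrow> v" using Cauchy_convergent convergentD by blast
  then have "v \<in> V" using closed_sequentially[OF V(2)] u(1) by blast
  moreover have "(\<lambda>n. dist x (u n)) \<longlonglongrightarrow> dist x v" by (intro tendsto_intros v)
  then have dv: "dist x v = ?d" using lim LIMSEQ_unique by blast
  have "inner (x - v) w = 0" if w: "w \<in> V" for w
  proof (rule ccontr)
    assume nz: "inner (x - v) w \<noteq> 0"
    then have ww: "inner w w > 0" by (cases "w = 0") auto
    \<comment> \<open>This \<open>t\<close> minimizes the distance from \<open>x\<close> to the line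
      through \<open>v\<close> in direction \<open>w\<close>; a nonzero inner product would make
      that point of \<open>V\<close> strictly closer than \<open>v\<close>.\<close>
    define t where "t = inner (x - v) w / inner w w"
    have "v + t *\<^sub>R w \<in> V"
      by (intro subspace_add subspace_scale V w \<open>v \<in> V\<close>)
    then have "dist x v \<le> dist x (v + t *\<^sub>R w)" unfolding dv by (rule infdist_le)
    then have "(norm (x - v))\<^sup>2 \<le> (norm ((x - v) - t *\<^sub>R w))\<^sup>2"
      by (intro power_mono) (auto simp: dist_norm diff_diff_eq)
    also have "\<dots> = (norm (x - v))\<^sup>2 - 2 * t * inner (x - v) w + t * (t * inner w w)"
      unfolding power2_norm_eq_inner
      by (simp only: inner_diff_left inner_diff_right inner_scaleR_left inner_scaleR_right inner_commute)
    also have "t * inner w w = inner (x - v) w" using ww by (simp add: t_def)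
    finally have "t * inner (x - v) w \<le> 0" by simp
    moreover have "t * inner (x - v) w > 0"
      using ww nz by (simp add: t_def zero_less_mult_iff divide_simps) linarith
    ultimately show False by simp
  qed
  ultimately show ?thesis by blast
qed


section \<open>Uniqueness of Fourier coefficients\<close>

lemma measurable_circle [measurable (raw)]:
  "f \<in> borel_measurable borel \<Longrightarrow> f \<in> borel_measurable circle"
  by (simp cong: measurable_cong_sets add: sets_circle measurable_restrict_space1)

lemma borel_measurable_powi [measurable]: "(\<lambda>z::complex. z powi n) \<in> borel_measurable circle"
  unfolding power_int_def by measurable

lemma integrable_circle_bounded_mult:
  fixes f :: "complex \<Rightarrow> complex"
  assumes "integrable circle f" and [measurable]: "h \<in> borel_measurable circle"
    and "\<And>z. cmod z = 1 \<Longrightarrow> cmod (h z) \<le> B"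
  shows "integrable circle (\<lambda>z. f z * h z)"
proof (rule Bochner_Integration.integrable_bound)
  show "integrable circle (\<lambda>z. B * cmod (f z))" using assms by simp
  show "(\<lambda>z. f z * h z) \<in> borel_measurable circle" using assms by simp
  have "cmod (f z * h z) \<le> norm (B * cmod (f z))" if "cmod z = 1" for z
  proof -
    have "cmod (f z * h z) \<le> cmod (f z) * B"
      using assms(3)[OF that] by (simp add: norm_mult mult_left_mono)
    then show ?thesis by (simp add: mult.commute)
  qed
  then show "AE z in circle. cmod (f z * h z) \<le> norm (B * cmod (f z))" by (intro AE_I2) auto
qed

text \<open>Pulled back along \<open>cis\<close>, the integrand is \<open>cis (n * t)\<close>, whose
  antiderivative \<open>cis (n * t) / (\<i> * n)\<close> takes the same value at both ends of the
  period.\<close>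

lemma integral_powi:
  assumes "n \<noteq> 0"
  shows "(LINT z|circle. z powi n) = 0"
proof -
  let ?I = "{0..<2 * pi}"
  have m: "cis \<in> measurable (uniform_measure lborel ?I) (restrict_space borel (sphere 0 1))"
    using measurable_cis by simp
  have "(\<lambda>z::complex. z powi n) \<in> borel_measurable (restrict_space borel (sphere 0 1))"
    using borel_measurable_powi[of n] by (simp cong: measurable_cong_sets add: sets_circle)
  then have "(LINT z|circle. z powi n) = (LINT t|uniform_measure lborel ?I. cis t powi n)"
    unfolding circle_def by (rule integral_distr[OF m])
  also have "\<dots> = (LINT t|density lborel (\<lambda>t. ennreal (indicator ?I t / (2 * pi))). cis (n * t))"
    unfolding uniform_measure_def
    by (simp add: cis_power_int divide_ennreal ennreal_indicator[symmetric])
  also have "\<dots> = (LINT t|lborel. (indicator ?I t / (2 * pi)) *\<^sub>R cis (n * t))"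
    by (intro integral_density)
      (auto intro!: borel_measurable_continuous_onI continuous_intros divide_nonneg_nonneg)
  \<comment> \<open>The fundamental theorem of calculus concerns the closed interval; the added end
    point is a null set.\<close>
  also have "\<dots> = (LINT t|lborel. (1 / (2 * pi)) *\<^sub>R (indicator {0..2 * pi} t *\<^sub>R cis (n * t)))"
  proof (rule integral_cong_AE)
    have "AE t in lborel. t \<noteq> 2 * pi" by (rule AE_lborel_singleton)
    then show "AE t in lborel. (indicator ?I t / (2 * pi)) *\<^sub>R cis (n * t) =
        (1 / (2 * pi)) *\<^sub>R (indicator {0..2 * pi} t *\<^sub>R cis (n * t))"
      by eventually_elim (auto simp: indicator_def)
    have [measurable]: "(\<lambda>t. cis (n * t)) \<in> borel_measurable lborel"
      by (auto intro!: borel_measurable_continuous_onI continuous_intros)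
    show "(\<lambda>t. (indicator ?I t / (2 * pi)) *\<^sub>R cis (n * t)) \<in> borel_measurable lborel"
      "(\<lambda>t. (1 / (2 * pi)) *\<^sub>R (indicator {0..2 * pi} t *\<^sub>R cis (n * t))) \<in> borel_measurable lborel"
      by measurable
  qed
  also have "\<dots> = (1 / (2 * pi)) *\<^sub>R (LINT t|lborel. indicator {0..2 * pi} t *\<^sub>R cis (n * t))"
    by (rule integral_scaleR_right)
  also have "(LINT t|lborel. indicator {0..2 * pi} t *\<^sub>R cis (n * t)) =
      cis (of_int n * (2 * pi)) / (\<i> * n) - cis (of_int n * 0) / (\<i> * n)"
  proof (rule integral_FTC_Icc[of 0 "2 * pi" "\<lambda>t. cis (of_int n * t) / (\<i> * n)"])
    show "((\<lambda>t. cis (of_int n * t) / (\<i> * n)) has_vector_derivative cis (of_int n * t))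
        (at t within {0..2 * pi})" for t :: real
      unfolding has_vector_derivative_complex_iff cis.ctr
      using assms by (auto simp: Re_divide Im_divide power2_eq_square intro!: derivative_eq_intros)
  qed (auto intro!: continuous_intros)
  also have "cis (of_int n * (2 * pi)) = 1"
    using cis_multiple_2pi[of "of_int n"] by (simp add: mult.commute)
  finally show ?thesis by simp
qed

text \<open>On the circle, real and imaginary part are combinations of \<open>z\<close> and its inverse, and multiplication
  by these shifts Fourier coefficients; hence one can induct on the polynomial.\<close>

lemma fourier_coeffs_zero_mult_polynomial:
  assumes "real_polynomial_function p"
    and "integrable circle f" "\<And>n. fourier_coeff f n = 0"
  shows "integrable circle (\<lambda>z. f z * of_real (p z)) \<and> (\<forall>n. fourier_coeff (\<lambda>z. f z * of_real (p z)) n = 0)"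
proof -
  define N where "N f \<longleftrightarrow> integrable circle f \<and> (\<forall>n. fourier_coeff f n = 0)" for f
  have powi: "cmod (z powi n) \<le> 1" if "cmod z = 1" for z n
    using that by (simp add: norm_power_int)
  have int: "integrable circle (\<lambda>z. f z * z powi n)" if "integrable circle f" for f n
    by (rule integrable_circle_bounded_mult[OF that _ powi]) measurable
  have add: "N (\<lambda>z. f z + h z)" if "N f" "N h" for f h
    using that by (auto simp: N_def fourier_coeff_def distrib_right int)
  have scale: "N (\<lambda>z. c * f z)" if "N f" for f c
    using that by (auto simp: N_def fourier_coeff_def mult.assoc)
  have shift: "N (\<lambda>z. f z * z powi m)" if "N f" for f m
    unfolding N_def
  proof (intro conjI allI)
    show "integrable circle (\<lambda>z. f z * z powi m)" using that int by (simp add: N_def)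
    show "fourier_coeff (\<lambda>z. f z * z powi m) n = 0" for n
    proof -
      have "fourier_coeff (\<lambda>z. f z * z powi m) n = fourier_coeff f (n - m)"
        unfolding fourier_coeff_def
      proof (rule Bochner_Integration.integral_cong)
        fix z assume "z \<in> space circle"
        then have "z \<noteq> 0" by auto
        then have "z powi - (n - m) = z powi m * z powi - n"
          by (simp flip: power_int_add)
        then show "f z * z powi m * z powi - n = f z * z powi - (n - m)" by (simp add: mult.assoc)
      qed simp
      then show ?thesis using that by (simp add: N_def)
    qed
  qed
  have cong: "N f = N h" if "\<And>z. cmod z = 1 \<Longrightarrow> f z = h z" for f h
    using that unfolding N_def fourier_coeff_def
    by (intro arg_cong2[of _ _ _ _ "(\<and>)"] Bochner_Integration.integrable_cong all_cong1
        arg_cong2[of _ _ _ _ "(=)"] Bochner_Integration.integral_cong) auto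
  \<comment> \<open>\<open>f\<close> is kept arbitrary for the case of products, where the
    hypothesis for \<open>q\<close> is applied to \<open>f\<close> times \<open>p\<close>.\<close>
  have "N f \<Longrightarrow> N (\<lambda>z. f z * of_real (p z))" for f
    using assms(1)
  proof (induction p arbitrary: f)
    case (linear p)
    \<comment> \<open>The coefficients of \<open>z\<close> and \<open>cnj z\<close> after writing
      \<open>Re z\<close> and \<open>Im z\<close> in \<open>Re z * p 1 + Im z * p \<i>\<close> as
      half sum and half difference of these two.\<close>
    define a b where "a = (of_real (p 1) - \<i> * of_real (p \<i>)) / 2"
      and "b = (of_real (p 1) + \<i> * of_real (p \<i>)) / 2"
    interpret p: bounded_linear p by fact
    have "N (\<lambda>z. a * (f z * z powi 1) + b * (f z * z powi - 1))"
      by (intro add scale shift linear)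
    also have "N (\<lambda>z. a * (f z * z powi 1) + b * (f z * z powi - 1)) = N (\<lambda>z. f z * of_real (p z))"
    proof (rule cong)
      fix z :: complex assume z: "cmod z = 1"
      have "p z = p (Re z *\<^sub>R 1 + Im z *\<^sub>R \<i>)"
        by (rule arg_cong[of _ _ p]) (simp add: complex_eq_iff)
      also have "\<dots> = Re z * p 1 + Im z * p \<i>"
        by (simp add: p.add p.scaleR)
      finally have "a * z + b * cnj z = of_real (p z)"
        by (simp add: a_def b_def complex_eq_iff field_simps)
      moreover have "z * cnj z = 1"
        using z by (simp flip: complex_norm_square)
      then have "z powi - 1 = cnj z"
        by (simp add: power_int_minus inverse_unique)
      ultimately show "a * (f z * z powi 1) + b * (f z * z powi - 1) = f z * of_real (p z)"
        by (metis distrib_left mult.left_commute power_int_1_right)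
    qed
    finally show ?case .
  next
    case (const c)
    then show ?case using scale[of f "of_real c"] by (simp add: mult.commute)
  next
    case (add p q)
    then show ?case using \<open>\<And>f h. N f \<Longrightarrow> N h \<Longrightarrow> N (\<lambda>z. f z + h z)\<close>[of "\<lambda>z. f z * of_real (p z)" "\<lambda>z. f z * of_real (q z)"]
      by (simp add: distrib_left)
  next
    case (mult p q)
    then have "N (\<lambda>z. (f z * of_real (p z)) * of_real (q z))" by blast
    then show ?case by (simp add: mult.assoc)
  qed
  then show ?thesis using assms by (auto simp: N_def)
qed

text \<open>By Stone-Weierstrass, \<open>c\<close> is uniformly close on the circle to a polynomial,
  against which \<open>f\<close> integrates to zero; the error is at most \<open>e\<close> times the
  integral of the modulus of \<open>f\<close>.\<close>

lemma fourier_coeffs_zero_integral_continuous: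
  fixes c :: "complex \<Rightarrow> real"
  assumes f: "integrable circle f" "\<And>n. fourier_coeff f n = 0"
    and c: "continuous_on UNIV c"
  shows "integrable circle (\<lambda>z. f z * of_real (c z))" "(LINT z|circle. f z * of_real (c z)) = 0"
proof -
  have bdd: "\<exists>B. \<forall>z. cmod z = 1 \<longrightarrow> \<bar>h z\<bar> \<le> B" if "continuous_on UNIV h" for h :: "complex \<Rightarrow> real"
  proof -
    have "bounded (h ` sphere 0 1)"
      by (intro compact_imp_bounded compact_continuous_image continuous_on_subset[OF that]) auto
    then show ?thesis by (fastforce simp: bounded_iff)
  qed
  have int: "integrable circle (\<lambda>z. f z * of_real (h z))" if h: "continuous_on UNIV h" for h :: "complex \<Rightarrow> real"
  proof -
    obtain B where "\<And>z. cmod z = 1 \<Longrightarrow> \<bar>h z\<bar> \<le> B" using bdd[OF h] by blast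
    moreover have "h \<in> borel_measurable borel" using h by (rule borel_measurable_continuous_onI)
    ultimately show ?thesis
      by (intro integrable_circle_bounded_mult f) auto
  qed
  show "integrable circle (\<lambda>z. f z * of_real (c z))" by (rule int[OF c])
  have small: "cmod (LINT z|circle. f z * of_real (c z)) \<le> e * (LINT z|circle. cmod (f z))" if e: "e > 0" for e
  proof -
    obtain p where p: "real_polynomial_function p" "\<And>z. z \<in> sphere 0 1 \<Longrightarrow> \<bar>c z - p z\<bar> < e"
      using Stone_Weierstrass_real_polynomial_function[OF compact_sphere continuous_on_subset[OF c subset_UNIV] e]
      by blast
    have pc: "continuous_on UNIV p"
      using p(1) by (simp add: continuous_on_polymonial_function real_polynomial_function_eq)
    have "(LINT z|circle. f z * of_real (p z)) = 0"
      using fourier_coeffs_zero_mult_polynomial[OF p(1) f] by (auto simp: fourier_coeff_def dest: spec[of _ 0])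
    then have "(LINT z|circle. f z * of_real (c z)) = (LINT z|circle. f z * of_real (c z) - f z * of_real (p z))"
      by (simp add: int c pc)
    also have "cmod \<dots> \<le> (LINT z|circle. e * cmod (f z))"
    proof (rule order_trans[OF integral_norm_bound], rule integral_mono)
      show "cmod (f z * of_real (c z) - f z * of_real (p z)) \<le> e * cmod (f z)"
        if "z \<in> space circle" for z
      proof -
        have "cmod (f z * of_real (c z) - f z * of_real (p z)) = cmod (f z) * \<bar>c z - p z\<bar>"
          by (simp flip: right_diff_distrib of_real_diff add: norm_mult)
        also have "\<dots> \<le> cmod (f z) * e"
          using p(2)[of z] that by (intro mult_left_mono) auto
        finally show ?thesis by (simp add: mult.commute)
      qed
    qed (use f in \<open>auto intro!: integrable_norm Bochner_Integration.integrable_diff int c pc\<close>)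
    finally show ?thesis by simp
  qed
  define J where "J = (LINT z|circle. cmod (f z))"
  have J: "J \<ge> 0" unfolding J_def by (rule Bochner_Integration.integral_nonneg) simp
  have "cmod (LINT z|circle. f z * of_real (c z)) \<le> 0 + e" if "e > 0" for e
  proof -
    \<comment> \<open>\<open>J + 1\<close> instead of \<open>J\<close> avoids a division by zero
      when \<open>f\<close> vanishes almost everywhere.\<close>
    have "cmod (LINT z|circle. f z * of_real (c z)) \<le> (e / (J + 1)) * J"
      unfolding J_def by (rule small) (use that J in \<open>simp flip: J_def\<close>)
    also have "\<dots> \<le> e" using that J by (simp add: field_simps)
    finally show ?thesis by simp
  qed
  then have "cmod (LINT z|circle. f z * of_real (c z)) \<le> 0" by (rule field_le_epsilon)
  then show "(LINT z|circle. f z * of_real (c z)) = 0" by simp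
qed

text \<open>The continuous functions \<open>c n\<close> equal 1 on \<open>A\<close> and are
  eventually 0 at each point off \<open>A\<close>, since a point off a closed set has positive
  distance to it. Dominated convergence passes to the indicator.\<close>

lemma fourier_coeffs_zero_integral_closed:
  assumes f: "integrable circle f" "\<And>n. fourier_coeff f n = 0"
    and A: "closed A"
  shows "(LINT z|circle. indicator A z *\<^sub>R f z) = 0"
proof (cases "A = {}")
  \<comment> \<open>\<open>infdist z {}\<close> is 0 by convention, so the functions
    \<open>c n\<close> would not tend to the indicator of the empty set.\<close>
  case False
  define c where "c n z = max 0 (1 - real n * infdist z A)" for n :: nat and z :: complex
  have c: "continuous_on UNIV (c n)" for n
    unfolding c_def by (intro continuous_intros)
  have [measurable]: "c n \<in> borel_measurable borel" for n by (rule borel_measurable_continuous_onI[OF c])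
  have [measurable]: "A \<in> sets borel" using A by simp
  have lim: "(\<lambda>n. c n z) \<longlonglongrightarrow> indicator A z" for z
  proof (cases "z \<in> A")
    case True
    then show ?thesis by (simp add: c_def)
  next
    case z: False
    have pos: "infdist z A > 0" by (rule infdist_pos_not_in_closed[OF A False z])
    obtain N where N: "1 < real N * infdist z A"
      using reals_Archimedean3[OF pos] by blast
    have "\<forall>\<^sub>F n in sequentially. c n z = 0"
      using eventually_ge_at_top[of N]
    proof eventually_elim
      case (elim n)
      then have "real N * infdist z A \<le> real n * infdist z A"
        using pos by (intro mult_right_mono) auto
      then show ?case using N by (simp add: c_def)
    qed
    then show ?thesis using z by (simp add: tendsto_eventually)
  qed
  have "(\<lambda>n. LINT z|circle. f z * of_real (c n z)) \<longlonglongrightarrow> (LINT z|circle. indicator A z *\<^sub>R f z)"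
  proof (rule integral_dominated_convergence)
    show "integrable circle (\<lambda>z. cmod (f z))" using f by simp
    show "AE z in circle. (\<lambda>n. f z * of_real (c n z)) \<longlonglongrightarrow> indicator A z *\<^sub>R f z"
    proof (rule AE_I2)
      fix z
      have "(\<lambda>n. f z * of_real (c n z)) \<longlonglongrightarrow> f z * of_real (indicator A z)"
        by (intro tendsto_intros lim)
      then show "(\<lambda>n. f z * of_real (c n z)) \<longlonglongrightarrow> indicator A z *\<^sub>R f z"
        by (simp add: scaleR_conv_of_real mult.commute)
    qed
    show "AE z in circle. cmod (f z * of_real (c n z)) \<le> cmod (f z)" for n
    proof (rule AE_I2)
      fix z
      have "\<bar>c n z\<bar> \<le> 1" by (auto simp: c_def infdist_nonneg)
      then show "cmod (f z * of_real (c n z)) \<le> cmod (f z)"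
        by (simp add: norm_mult mult_left_le)
    qed
  qed (use f in measurable)
  then show ?thesis
    using fourier_coeffs_zero_integral_continuous(2)[OF f c] by (simp add: LIMSEQ_const_iff)
qed simp

text \<open>The closed sets are an intersection-stable generator of the Borel sets, so Dynkin's
  argument extends the vanishing of integrals of \<open>f\<close> from closed to Borel sets; a
  function with all these integrals zero vanishes almost everywhere.\<close>

lemma AE_eq_0_if_fourier_coeffs_zero:
  assumes f: "integrable circle f" "\<And>n. fourier_coeff f n = 0"
  shows "AE z in circle. f z = 0"
proof (rule circle.density_zero[OF f(1)])
  fix A assume "A \<in> sets circle"
  then have "A \<in> sets borel"
    by (simp add: sets_circle sets_restrict_space_iff)
  then have "A \<in> sigma_sets UNIV (Collect closed)"
    by (simp add: borel_eq_closed)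
  have borel: "B \<in> sets borel" if "B \<in> sigma_sets UNIV (Collect closed)" for B :: "complex set"
    using that by (simp add: borel_eq_closed)
  have int: "integrable circle (\<lambda>z. indicator B z *\<^sub>R f z)" if "B \<in> sets borel" for B
    by (rule Bochner_Integration.integrable_bound[OF f(1)]) (use that f(1) in \<open>auto simp: indicator_def\<close>)
  have "Int_stable (Collect (closed :: complex set \<Rightarrow> bool))" "Collect closed \<subseteq> Pow (UNIV :: complex set)"
    by (auto simp: Int_stable_def)
  from this \<open>A \<in> sigma_sets UNIV (Collect closed)\<close>
  show "set_lebesgue_integral circle A f = 0"
    unfolding set_lebesgue_integral_def
  proof (induction rule: sigma_sets_induct_disjoint)
    case (compl B)
    have "indicator (UNIV - B) z *\<^sub>R f z = indicator UNIV z *\<^sub>R f z - indicator B z *\<^sub>R f z" for z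
      by (auto simp: indicator_def)
    then show ?case
      using compl.IH borel[OF compl.hyps] fourier_coeffs_zero_integral_closed[OF f, of UNIV] int
      by (simp add: f)
  next
    case (union B)
    have B: "B i \<in> sets borel" for i using union.hyps borel by auto
    \<comment> \<open>The sets \<open>B i\<close> lie in the plane; only their traces on the sphere
      belong to \<open>sets circle\<close>.\<close>
    have "(LINT z|circle. indicator (\<Union>i. B i) z *\<^sub>R f z) = (LINT z:(\<Union>i. B i \<inter> sphere 0 1)|circle. f z)"
      unfolding set_lebesgue_integral_def
      by (intro Bochner_Integration.integral_cong) (auto simp: indicator_def)
    also have "\<dots> = (\<Sum>i. LINT z:(B i \<inter> sphere 0 1)|circle. f z)"
    proof (rule lebesgue_integral_countable_add)
      show "B i \<inter> sphere 0 1 \<in> sets circle" for i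
        using B[of i] by (auto simp: sets_circle sets_restrict_space)
      show "B i \<inter> sphere 0 1 \<inter> (B j \<inter> sphere 0 1) = {}" if "i \<noteq> j" for i j
        using union.hyps(1) that by (auto simp: disjoint_family_on_def)
      show "set_integrable circle (\<Union>i. B i \<inter> sphere 0 1) f"
        unfolding set_integrable_def by (rule int) (use B in auto)
    qed
    also have "\<dots> = (\<Sum>i. LINT z|circle. indicator (B i) z *\<^sub>R f z)"
      unfolding set_lebesgue_integral_def
      by (intro arg_cong[of _ _ suminf] ext Bochner_Integration.integral_cong) (auto simp: indicator_def)
    finally show ?case using union.IH by simp
  qed (auto intro: fourier_coeffs_zero_integral_closed[OF f])
qed


section \<open>Bounded operators and the Hardy space\<close>

lemma scaleC_zero_right [simp]: "c *\<^sub>C (0 :: 'a::complex_normed_vector) = 0"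
  using scaleC_add_right[of c 0 0] by simp

lemma scaleC_minus_one: "(- 1) *\<^sub>C x = - (x :: 'a::complex_normed_vector)"
  using scaleC_of_real[of "- 1" x] by simp

lemma scaleC_diff_right: "c *\<^sub>C (x - y :: 'a::complex_normed_vector) = c *\<^sub>C x - c *\<^sub>C y"
  using scaleC_add_right[of c "x - y" y] by simp

lemma complex_subspace_diff:
  assumes "complex_subspace V" "x \<in> V" "y \<in> V"
  shows "x - y \<in> (V :: 'a::complex_normed_vector set)"
proof -
  have "x + (- 1) *\<^sub>C y \<in> V" using assms by (simp add: complex_subspace_def)
  then show ?thesis by (simp add: scaleC_minus_one)
qed

lemma complex_subspace_imp_subspace: "complex_subspace V \<Longrightarrow> subspace V"
  unfolding complex_subspace_def subspace_def by (metis scaleC_of_real)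

text \<open>Operators are built on whole types, where closure under sums and composition has no side
  conditions on carriers; \<open>bounded_op_restrict\<close> passes to the carriers
  afterwards.\<close>

abbreviation bounded_op :: "('a::complex_normed_vector \<Rightarrow> 'b::complex_normed_vector) \<Rightarrow> bool"
  where "bounded_op \<equiv> bounded_operator UNIV UNIV"

lemma bounded_opI:
  assumes "\<And>x y. T (x + y) = T x + T y" "\<And>c x. T (c *\<^sub>C x) = c *\<^sub>C T x"
    "\<And>x. norm (T x) \<le> K * norm x"
  shows "bounded_op T"
  using assms by (auto simp: bounded_operator_def)

lemma bounded_opE:
  assumes "bounded_op T"
  obtains K where "K \<ge> 0" "\<And>x y. T (x + y) = T x + T y" "\<And>c x. T (c *\<^sub>C x) = c *\<^sub>C T x"
    "\<And>x. norm (T x) \<le> K * norm x"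
proof -
  obtain K where K: "\<And>x. norm (T x) \<le> K * norm x"
    using assms by (auto simp: bounded_operator_def)
  have "norm (T x) \<le> \<bar>K\<bar> * norm x" for x
    by (rule order_trans[OF K]) (simp add: mult_right_mono)
  with that[of "\<bar>K\<bar>"] show ?thesis
    using assms by (auto simp: bounded_operator_def)
qed

lemma bounded_op_restrict:
  "bounded_op T \<Longrightarrow> (\<And>x. x \<in> X \<Longrightarrow> T x \<in> Y) \<Longrightarrow> bounded_operator X Y T"
  by (auto simp: bounded_operator_def)

lemma bounded_op_imp_bounded_linear:
  assumes "bounded_op T"
  shows "bounded_linear T"
proof -
  obtain K where K: "\<And>x y. T (x + y) = T x + T y" "\<And>c x. T (c *\<^sub>C x) = c *\<^sub>C T x"
    "\<And>x. norm (T x) \<le> K * norm x"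
    using bounded_opE[OF assms] by metis
  show ?thesis
    by (rule bounded_linear_intro[of _ K]) (auto simp: K mult.commute simp flip: scaleC_of_real)
qed

lemma bounded_op_ident: "bounded_op (\<lambda>x. x)"
  by (rule bounded_opI[of _ 1]) auto

lemma bounded_op_zero: "bounded_op (\<lambda>x. 0)"
  by (rule bounded_opI[of _ 0]) auto

lemma bounded_op_compose:
  assumes "bounded_op S" "bounded_op T"
  shows "bounded_op (\<lambda>x. S (T x))"
proof -
  obtain K where K: "K \<ge> 0" "\<And>x y. S (x + y) = S x + S y" "\<And>c x. S (c *\<^sub>C x) = c *\<^sub>C S x"
    "\<And>x. norm (S x) \<le> K * norm x"
    using bounded_opE[OF assms(1)] by metis
  obtain L where L: "L \<ge> 0" "\<And>x y. T (x + y) = T x + T y" "\<And>c x. T (c *\<^sub>C x) = c *\<^sub>C T x"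
    "\<And>x. norm (T x) \<le> L * norm x"
    using bounded_opE[OF assms(2)] by metis
  have "norm (S (T x)) \<le> (K * L) * norm x" for x
    using order_trans[OF K(4) mult_left_mono[OF L(4) K(1)]] by (simp add: mult.assoc)
  then show ?thesis by (intro bounded_opI) (auto simp: K L)
qed

lemma bounded_op_add:
  assumes "bounded_op S" "bounded_op T"
  shows "bounded_op (\<lambda>x. S x + T x)"
proof -
  obtain K where K: "\<And>x y. S (x + y) = S x + S y" "\<And>c x. S (c *\<^sub>C x) = c *\<^sub>C S x"
    "\<And>x. norm (S x) \<le> K * norm x"
    using bounded_opE[OF assms(1)] by metis
  obtain L where L: "\<And>x y. T (x + y) = T x + T y" "\<And>c x. T (c *\<^sub>C x) = c *\<^sub>C T x"
    "\<And>x. norm (T x) \<le> L * norm x"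
    using bounded_opE[OF assms(2)] by metis
  have "norm (S x + T x) \<le> (K + L) * norm x" for x
    using norm_triangle_mono[OF K(3) L(3)] by (simp add: distrib_right)
  then show ?thesis by (intro bounded_opI) (auto simp: K L scaleC_add_right)
qed

lemma bounded_op_diff:
  assumes "bounded_op S" "bounded_op T"
  shows "bounded_op (\<lambda>x. S x - T x)"
proof -
  have "bounded_op (\<lambda>y. (- 1) *\<^sub>C y :: 'b)"
    by (rule bounded_opI[of _ 1]) (auto simp: scaleC_add_right scaleC_scaleC norm_scaleC)
  from bounded_op_add[OF assms(1) bounded_op_compose[OF this assms(2)]]
  show ?thesis by (simp add: scaleC_minus_one)
qed

lemma bounded_op_fst: "bounded_op T \<Longrightarrow> bounded_op (\<lambda>x. fst (T x))"
  by (rule bounded_op_compose[of fst], rule bounded_opI[of _ 1])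
    (auto simp: scaleC_prod_def norm_fst_le)

lemma bounded_op_snd: "bounded_op T \<Longrightarrow> bounded_op (\<lambda>x. snd (T x))"
  by (rule bounded_op_compose[of snd], rule bounded_opI[of _ 1])
    (auto simp: scaleC_prod_def norm_snd_le)

lemma bounded_op_Pair:
  assumes "bounded_op S" "bounded_op T"
  shows "bounded_op (\<lambda>x. (S x, T x))"
proof -
  have "bounded_op (\<lambda>x :: 'b. (x, 0 :: 'c))" "bounded_op (\<lambda>x :: 'c. (0 :: 'b, x))"
    by (rule bounded_opI[of _ 1]; simp add: scaleC_prod_def)+
  from bounded_op_add[OF bounded_op_compose[OF this(1) assms(1)] bounded_op_compose[OF this(2) assms(2)]]
  show ?thesis by simp
qed

lemma bounded_op_vec_nth: "bounded_op T \<Longrightarrow> bounded_op (\<lambda>x. T x $ i)"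
  by (rule bounded_op_compose[of "\<lambda>x. x $ i"], rule bounded_opI[of _ 1])
    (auto simp: scaleC_vec_def Finite_Cartesian_Product.norm_nth_le)

lemma bounded_op_vecI:
  assumes "\<And>i. bounded_op (\<lambda>x. T x $ i)"
  shows "bounded_op T"
proof -
  have "\<exists>K. (\<forall>x. norm (T x $ i) \<le> K * norm x)" for i
    using bounded_opE[OF assms[of i]] by metis
  then obtain K where K: "\<And>i x. norm (T x $ i) \<le> K i * norm x" by metis
  show ?thesis
  proof (rule bounded_opI)
    show "T (x + y) = T x + T y" for x y
      using assms by (simp add: vec_eq_iff bounded_operator_def)
    show "T (c *\<^sub>C x) = c *\<^sub>C T x" for c x
      using assms by (simp add: vec_eq_iff scaleC_vec_def bounded_operator_def)
    show "norm (T x) \<le> (\<Sum>i\<in>UNIV. K i) * norm x" for x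
      unfolding norm_vec_def sum_distrib_right
      by (rule order_trans[OF L2_set_le_sum]) (auto intro!: sum_mono K)
  qed
qed

lemma bounded_op_mult_L2: "f \<in> Linf \<Longrightarrow> bounded_op (mult_L2 f)"
  using norm_mult_L2_le[of f] by (auto simp: bounded_operator_def mult_L2_add mult_L2_scaleC)

section \<open>Orthogonal complements and projections onto closed subspaces\<close>

definition orth_compl :: "L2 set \<Rightarrow> L2 set" where
  "orth_compl S = {x. \<forall>y\<in>S. cinner x y = 0}"

lemma complex_subspace_orth_compl: "complex_subspace (orth_compl S)"
  by (auto simp: complex_subspace_def orth_compl_def cinner_add_left cinner_scaleC_left)

lemma continuous_cinner_left: "continuous_on UNIV (\<lambda>x. cinner x y)"
proof (rule linear_continuous_on)
  show "bounded_linear (\<lambda>x. cinner x y)"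
  proof (rule bounded_linear_intro)
    show "cinner (r *\<^sub>R x) y = r *\<^sub>R cinner x y" for r x
      using cinner_scaleC_left[of "of_real r" x y] by (simp add: scaleC_of_real scaleR_conv_of_real)
  qed (rule cinner_add_left norm_cinner_le)+
qed

lemma closed_orth_compl: "closed (orth_compl S)"
proof -
  have "orth_compl S = (\<Inter>y\<in>S. {x. cinner x y = 0})" by (auto simp: orth_compl_def)
  then show ?thesis
    by (auto intro!: closed_Collect_eq continuous_cinner_left continuous_intros)
qed

locale closed_subspace =
  fixes V :: "L2 set"
  assumes subspace: "complex_subspace V" and closed: "closed V"
begin

text \<open>\<open>orth_proj\<close> is a definite description, evaluated here by uniqueness: the
  difference of two candidates lies in \<open>V\<close> and is orthogonal to \<open>V\<close>, hence
  to itself.\<close>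

lemma orth_proj_unique:
  assumes "h \<in> V" "\<And>m. m \<in> V \<Longrightarrow> cinner (x - h) m = 0"
  shows "orth_proj V x = h"
  unfolding orth_proj_def
proof (rule the_equality)
  fix k assume k: "k \<in> V \<and> (\<forall>m\<in>V. cinner (x - k) m = 0)"
  have "k - h \<in> V" using assms k by (intro complex_subspace_diff subspace) auto
  then have "cinner (x - h) (k - h) = 0" "cinner (x - k) (k - h) = 0" using k assms by auto
  then have "cinner (k - h) (k - h) = 0"
    by (simp add: cinner_diff_left)
  then show "k = h" by (simp add: cinner_self_eq_0)
qed (use assms in auto)

text \<open>The real projection theorem only annihilates the real part of \<open>cinner\<close>.
  Applying it also to the multiple of \<open>w\<close> by \<open>\<i>\<close>, which stays in the
  complex subspace \<open>V\<close>, annihilates the imaginary part.\<close>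

lemma orth_proj: "orth_proj V x \<in> V" "m \<in> V \<Longrightarrow> cinner (x - orth_proj V x) m = 0"
proof -
  obtain v where v: "v \<in> V" "\<And>w. w \<in> V \<Longrightarrow> inner (x - v) w = 0"
    using orthogonal_projection_exists[OF complex_subspace_imp_subspace[OF subspace] closed, of x] by blast
  have orth: "cinner (x - v) w = 0" if w: "w \<in> V" for w
  proof -
    have "\<i> *\<^sub>C w \<in> V" using subspace w by (simp add: complex_subspace_def)
    then have "Re (cinner (x - v) (\<i> *\<^sub>C w)) = 0" using v(2) by (simp flip: inner_L2_def)
    moreover have "Re (cinner (x - v) w) = 0" using v(2)[OF w] by (simp flip: inner_L2_def)
    ultimately show ?thesis by (simp add: cinner_scaleC_right complex_eq_iff)
  qed
  have "orth_proj V x = v" by (rule orth_proj_unique[OF v(1) orth])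
  then show "orth_proj V x \<in> V" "m \<in> V \<Longrightarrow> cinner (x - orth_proj V x) m = 0"
    using v(1) orth by auto
qed

lemma orth_proj_eq_0_iff: "orth_proj V x = 0 \<longleftrightarrow> (\<forall>m\<in>V. cinner x m = 0)"
proof
  assume "orth_proj V x = 0"
  then show "\<forall>m\<in>V. cinner x m = 0" using orth_proj(2)[of _ x] by simp
next
  assume "\<forall>m\<in>V. cinner x m = 0"
  then show "orth_proj V x = 0"
    using subspace by (intro orth_proj_unique) (auto simp: complex_subspace_def)
qed

lemma orth_proj_ident: "x \<in> V \<Longrightarrow> orth_proj V x = x"
  by (rule orth_proj_unique) auto

lemma bounded_op_orth_proj: "bounded_op (orth_proj V)"
proof (rule bounded_opI)
  show "orth_proj V (x + y) = orth_proj V x + orth_proj V y" for x y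
  proof (rule orth_proj_unique)
    show "cinner (x + y - (orth_proj V x + orth_proj V y)) m = 0" if "m \<in> V" for m
      using orth_proj(2)[OF that, of x] orth_proj(2)[OF that, of y]
      by (simp add: cinner_add_left cinner_diff_left)
  qed (use subspace orth_proj in \<open>auto simp: complex_subspace_def\<close>)
  show "orth_proj V (c *\<^sub>C x) = c *\<^sub>C orth_proj V x" for c x
  proof (rule orth_proj_unique)
    show "cinner (c *\<^sub>C x - c *\<^sub>C orth_proj V x) m = 0" if "m \<in> V" for m
      using orth_proj(2)[OF that, of x]
      by (simp add: cinner_scaleC_left flip: scaleC_diff_right)
  qed (use subspace orth_proj in \<open>auto simp: complex_subspace_def\<close>)
  show "norm (orth_proj V x) \<le> 1 * norm x" for x
  proof -
    have "cinner x (orth_proj V x) = cinner (orth_proj V x) (orth_proj V x)"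
      using orth_proj(2)[OF orth_proj(1), of x x] by (simp add: cinner_diff_left)
    then have "(norm (orth_proj V x))\<^sup>2 = inner x (orth_proj V x)"
      by (simp add: power2_norm_eq_inner inner_L2_def)
    also have "\<dots> \<le> norm x * norm (orth_proj V x)" by (rule norm_cauchy_schwarz)
    finally show ?thesis
      by (cases "norm (orth_proj V x) = 0") (auto simp: power2_eq_square)
  qed
qed

lemma complex_banach: "complex_banach V"
  using subspace closed by (simp add: complex_banach_def complete_eq_closed)

end

lemma closed_subspace_orth_compl: "closed_subspace (orth_compl S)"
  by unfold_locales (rule complex_subspace_orth_compl closed_orth_compl)+

section \<open>Monomials and the Hardy space\<close>

lemma Linf_powi: "(\<lambda>z. z powi n) \<in> Linf"
  unfolding Linf_def by (auto intro!: exI[of _ 1] AE_I2 simp: norm_power_int)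

lemma square_integrable_one: "square_integrable (\<lambda>_. 1)"
  by (simp add: square_integrable_def)

definition monomial :: "int \<Rightarrow> L2" where
  "monomial n = abs_L2 (\<lambda>z. z powi n)"

lemma square_integrable_powi: "square_integrable (\<lambda>z. z powi n)"
  using square_integrable_mult[OF Linf_powi square_integrable_one] by simp

lemma cnj_powi:
  assumes "cmod z = 1"
  shows "cnj z powi n = z powi (- n)"
proof -
  have "z * cnj z = 1"
    using assms by (simp flip: complex_norm_square)
  then have "cnj z = inverse z" by (simp add: inverse_unique)
  then show ?thesis by (simp add: power_int_minus power_int_inverse)
qed

lemma cinner_monomial:
  assumes "square_integrable f"
  shows "cinner (abs_L2 f) (monomial n) = fourier_coeff f n"
  unfolding monomial_def cinner_abs_L2[OF assms square_integrable_powi] fourier_coeff_def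
  by (intro Bochner_Integration.integral_cong) (auto simp: cnj_powi)

lemma cinner_monomial_monomial:
  assumes "m \<noteq> n"
  shows "cinner (monomial m) (monomial n) = 0"
proof -
  have "cinner (monomial m) (monomial n) = (LINT z|circle. z powi m * z powi - n)"
    unfolding monomial_def[of m] by (simp add: cinner_monomial square_integrable_powi fourier_coeff_def)
  also have "\<dots> = (LINT z|circle. z powi (m - n))"
  proof (intro Bochner_Integration.integral_cong refl)
    fix z assume "z \<in> space circle"
    then have "z \<noteq> 0" by auto
    then show "z powi m * z powi - n = z powi (m - n)" by (simp flip: power_int_add)
  qed
  finally show ?thesis using integral_powi[of "m - n"] assms by simp
qed

text \<open>Completeness of the trigonometric system. Pairing with the constant 1 shows that a
  square-integrable function is integrable, so the uniqueness of Fourier coefficients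
  applies.\<close>

lemma eq_0_if_orthogonal_monomials:
  assumes "\<And>n. cinner x (monomial n) = 0"
  shows "x = 0"
proof (cases x rule: L2_cases)
  case (1 f)
  have "integrable circle f"
    using integrable_mult_cnj[OF 1(1) square_integrable_one] by simp
  moreover have "fourier_coeff f n = 0" for n
    using assms[of n] 1 by (simp add: cinner_monomial)
  ultimately have "AE z in circle. f z = 0" by (rule AE_eq_0_if_fourier_coeffs_zero)
  then show ?thesis
    using 1 by (simp add: zero_L2_def abs_L2_eq_iff square_integrable_zero)
qed

text \<open>As an orthogonal complement, \<open>H2\<close> is a closed complex subspace, and
  membership is a condition on inner products without representatives.\<close>

lemma H2_eq: "H2 = orth_compl (monomial ` {..<0})"
proof safe
  fix x assume "x \<in> H2"
  then show "x \<in> orth_compl (monomial ` {..<0})"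
    by (auto simp: H2_def orth_compl_def cinner_monomial)
next
  fix x assume x: "x \<in> orth_compl (monomial ` {..<0})"
  obtain f where "square_integrable f" "x = abs_L2 f" by (rule L2_cases)
  with x show "x \<in> H2"
    by (auto simp: H2_def orth_compl_def cinner_monomial)
qed

text \<open>The double orthogonal complement stands for the closed span of the monomials.\<close>

lemma H2_subset_double_orth_compl: "H2 \<subseteq> orth_compl (orth_compl (monomial ` {0..}))"
proof
  fix h assume h: "h \<in> H2"
  let ?S = "monomial ` {0..}"
  interpret closed_subspace "orth_compl (orth_compl ?S)" by (rule closed_subspace_orth_compl)
  let ?v = "orth_proj (orth_compl (orth_compl ?S)) h"
  \<comment> \<open>For \<open>n \<ge> 0\<close> this is the projection property; for
    \<open>n < 0\<close> both \<open>h\<close> and \<open>?v\<close> are orthogonal to the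
    monomial.\<close>
  have "cinner (h - ?v) (monomial n) = 0" for n
  proof (cases "n \<ge> 0")
    case True
    then have "monomial n \<in> orth_compl (orth_compl ?S)"
      by (auto simp: orth_compl_def) (metis cinner_commute complex_cnj_zero atLeast_iff imageI)
    then show ?thesis by (rule orth_proj(2))
  next
    case False
    then have "monomial n \<in> orth_compl ?S"
      by (auto simp: orth_compl_def cinner_monomial_monomial)
    then have "cinner ?v (monomial n) = 0"
      using orth_proj(1)[of h] by (simp add: orth_compl_def[of "orth_compl ?S"])
    moreover have "cinner h (monomial n) = 0"
      using h False by (simp add: H2_eq orth_compl_def)
    ultimately show ?thesis by (simp add: cinner_diff_left)
  qed
  then have "h - ?v = 0" by (rule eq_0_if_orthogonal_monomials)
  then show "h \<in> orth_compl (orth_compl ?S)" using orth_proj(1)[of h] by simp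
qed

text \<open>With \<open>f\<close> moved to the other factor, it remains to see that its conjugate
  times \<open>monomial m\<close> is orthogonal to \<open>H2\<close>. Against
  \<open>monomial n\<close> with \<open>n \<ge> 0\<close> this is the vanishing of the coefficient
  of \<open>f\<close> at \<open>m - n < 0\<close>, and the double orthogonal complement extends it
  to all of \<open>H2\<close>.\<close>

lemma Hinf_mult_H2:
  assumes "f \<in> Hinf" "h \<in> H2"
  shows "mult_L2 f h \<in> H2"
proof -
  have f: "f \<in> Linf" using assms by (simp add: Hinf_def)
  have "cinner (mult_L2 f h) (monomial m) = 0" if m: "m < 0" for m
  proof -
    have "mult_L2 (\<lambda>z. cnj (f z)) (monomial m) \<in> orth_compl (monomial ` {0..})"
      unfolding orth_compl_def
    proof safe
      fix n :: int assume n: "n \<ge> 0"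
      have "cinner (monomial n) (mult_L2 (\<lambda>z. cnj (f z)) (monomial m)) =
          cinner (abs_L2 (\<lambda>z. f z * z powi n)) (monomial m)"
        by (simp add: cinner_mult_L2_left[OF f, symmetric] monomial_def[of n] mult_abs_L2 f
            square_integrable_powi)
      also have "\<dots> = fourier_coeff (\<lambda>z. f z * z powi n) m"
        by (intro cinner_monomial square_integrable_mult f square_integrable_powi)
      also have "\<dots> = fourier_coeff f (m - n)"
        unfolding fourier_coeff_def
      proof (intro Bochner_Integration.integral_cong refl)
        fix z assume "z \<in> space circle"
        then have "z \<noteq> 0" by auto
        then have "z powi - (m - n) = z powi n * z powi - m"
          by (simp flip: power_int_add)
        then show "f z * z powi n * z powi - m = f z * z powi - (m - n)" by (simp add: mult.assoc)
      qed
      also have "\<dots> = 0" using assms(1) m n by (simp add: Hinf_def)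
      finally show "cinner (mult_L2 (\<lambda>z. cnj (f z)) (monomial m)) (monomial n) = 0"
        by (metis cinner_commute complex_cnj_zero)
    qed
    then show ?thesis
      using assms(2) H2_subset_double_orth_compl
      by (auto simp: cinner_mult_L2_left[OF f] orth_compl_def)
  qed
  then show ?thesis by (auto simp: H2_eq orth_compl_def)
qed


section \<open>Projections onto model spaces and dual-band spaces\<close>

lemma vector_4:
  "(vector [a, b, c, d] :: 'a::zero ^ 4) $ 1 = a"
  "(vector [a, b, c, d] :: 'a::zero ^ 4) $ 2 = b"
  "(vector [a, b, c, d] :: 'a::zero ^ 4) $ 3 = c"
  "(vector [a, b, c, d] :: 'a::zero ^ 4) $ 4 = d"
  unfolding vector_def by simp_all

lemma bounded_op_vector_4:
  fixes a b c d :: "'a::complex_normed_vector \<Rightarrow> 'b::complex_normed_vector"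
  assumes "bounded_op a" "bounded_op b" "bounded_op c" "bounded_op d"
  shows "bounded_op (\<lambda>x. vector [a x, b x, c x, d x] :: 'b ^ 4)"
proof (rule bounded_op_vecI)
  have "\<forall>i. bounded_op (\<lambda>x. (vector [a x, b x, c x, d x] :: 'b ^ 4) $ i)"
    by (simp add: forall_4 vector_4 assms)
  then show "bounded_op (\<lambda>x. (vector [a x, b x, c x, d x] :: 'b ^ 4) $ i)" for i by blast
qed

lemma H2_vec_4_iff:
  "(vector [a, b, c, d] :: L2 ^ 4) \<in> H2_vec \<longleftrightarrow> a \<in> H2 \<and> b \<in> H2 \<and> c \<in> H2 \<and> d \<in> H2"
  by (auto simp: H2_vec_def forall_4 vector_4)

lemma bounded_op_apply_add: "bounded_op T \<Longrightarrow> T (x + y) = T x + T y"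
  by (simp add: bounded_operator_def)

lemma bounded_op_apply_diff: "bounded_op T \<Longrightarrow> T (x - y) = T x - T y"
  by (metis add_diff_cancel diff_add_cancel bounded_op_apply_add)

lemma bounded_op_apply_zero: "bounded_op T \<Longrightarrow> T 0 = 0"
  by (metis add_cancel_left_right add_0 bounded_op_apply_add)

interpretation H2: closed_subspace H2
  unfolding H2_eq by (rule closed_subspace_orth_compl)

lemma complex_banach_H2_vec: "complex_banach (H2_vec :: (L2 ^ 'n) set)"
proof -
  have eq: "(H2_vec :: (L2 ^ 'n) set) = (\<Inter>i. {f. f $ i \<in> H2})" by (auto simp: H2_vec_def)
  have "closed {f :: L2 ^ 'n. f $ i \<in> H2}" for i
    using closed_vimage[OF H2.closed continuous_on_component[OF continuous_on_id], of i]
    by (simp add: vimage_def)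
  then have "closed (H2_vec :: (L2 ^ 'n) set)" unfolding eq by (intro closed_INT ballI)
  moreover have "complex_subspace (H2_vec :: (L2 ^ 'n) set)"
    using H2.subspace by (auto simp: complex_subspace_def H2_vec_def scaleC_vec_def)
  ultimately show ?thesis by (simp add: complex_banach_def complete_eq_closed)
qed

lemma bounded_op_toeplitz:
  assumes "\<And>i j. (\<lambda>z. G z $ i $ j) \<in> Linf"
  shows "bounded_op (toeplitz G)"
proof (rule bounded_op_vecI)
  have sum: "bounded_op (\<lambda>f. \<Sum>j\<in>A. mult_L2 (\<lambda>z. G z $ i $ j) (f $ j))" if "finite A" for A i
    using that
    by (induction A)
      (auto intro!: bounded_op_zero bounded_op_add bounded_op_compose[OF bounded_op_mult_L2]
        bounded_op_vec_nth bounded_op_ident assms)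
  show "bounded_op (\<lambda>f. toeplitz G f $ i)" for i
    unfolding toeplitz_def by (simp add: bounded_op_compose[OF H2.bounded_op_orth_proj sum])
qed

lemma toeplitz_in_H2_vec: "toeplitz G f \<in> H2_vec"
  by (simp add: H2_vec_def toeplitz_def H2.orth_proj(1))

section \<open>The model space of an inner function\<close>

locale inner_symbol =
  fixes \<theta> :: "complex \<Rightarrow> complex"
  assumes inner: "inner_function \<theta>"
begin

lemma \<theta>_Linf: "\<theta> \<in> Linf" and \<theta>_unimodular: "unimodular \<theta>" and \<theta>_Hinf: "\<theta> \<in> Hinf"
  using inner by (auto simp: inner_function_def Hinf_def)

definition mult_theta :: "L2 \<Rightarrow> L2" where
  "mult_theta = mult_L2 \<theta>"

text \<open>The Toeplitz operator with symbol \<open>cnj \<theta>\<close>; on \<open>H2\<close> it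
  is the adjoint and a left inverse of \<open>mult_theta\<close>.\<close>

definition coshift :: "L2 \<Rightarrow> L2" where
  "coshift x = orth_proj H2 (mult_L2 (\<lambda>z. cnj (\<theta> z)) x)"

text \<open>The projection onto the model space as an explicit formula, so that boundedness is
  immediate and closedness of the model space need not be known first.\<close>

definition model_proj :: "L2 \<Rightarrow> L2" where
  "model_proj x = orth_proj H2 x - mult_theta (coshift x)"

lemma bounded_op_mult_theta: "bounded_op mult_theta"
  unfolding mult_theta_def by (rule bounded_op_mult_L2[OF \<theta>_Linf])

lemma bounded_op_coshift: "bounded_op coshift"
  unfolding coshift_def
  by (rule bounded_op_compose[OF H2.bounded_op_orth_proj bounded_op_mult_L2[OF Linf_cnj[OF \<theta>_Linf]]])

lemma bounded_op_model_proj: "bounded_op model_proj"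
  unfolding model_proj_def
  by (rule bounded_op_diff[OF H2.bounded_op_orth_proj bounded_op_compose[OF bounded_op_mult_theta bounded_op_coshift]])

lemma mult_theta_H2: "x \<in> H2 \<Longrightarrow> mult_theta x \<in> H2"
  unfolding mult_theta_def by (rule Hinf_mult_H2[OF \<theta>_Hinf])

lemma coshift_H2: "coshift x \<in> H2"
  unfolding coshift_def by (rule H2.orth_proj(1))

lemma cinner_mult_theta: "cinner (mult_theta x) (mult_theta y) = cinner x y"
  unfolding mult_theta_def by (simp add: cinner_mult_L2_left \<theta>_Linf mult_L2_cnj_unimodular \<theta>_unimodular)

lemma cinner_coshift: "h \<in> H2 \<Longrightarrow> cinner (coshift x) h = cinner x (mult_theta h)"
  using H2.orth_proj(2)[of h "mult_L2 (\<lambda>z. cnj (\<theta> z)) x"]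
  by (simp add: coshift_def mult_theta_def cinner_diff_left cinner_mult_L2_left[OF Linf_cnj[OF \<theta>_Linf]])

lemma coshift_mult_theta: "x \<in> H2 \<Longrightarrow> coshift (mult_theta x) = x"
  by (simp add: coshift_def mult_theta_def mult_L2_cnj_unimodular \<theta>_Linf \<theta>_unimodular H2.orth_proj_ident)

lemma coshift_orth_proj: "coshift (orth_proj H2 x) = coshift x"
proof -
  have "coshift (x - orth_proj H2 x) = 0"
    unfolding coshift_def H2.orth_proj_eq_0_iff
    by (simp add: cinner_mult_L2_left[OF Linf_cnj[OF \<theta>_Linf]] H2.orth_proj(2) mult_theta_H2[unfolded mult_theta_def])
  then show ?thesis by (simp add: bounded_op_apply_diff[OF bounded_op_coshift])
qed

lemma model_space_subset_H2: "model_space \<theta> \<subseteq> H2"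
  by (auto simp: model_space_def)

lemma coshift_model_space: "k \<in> model_space \<theta> \<Longrightarrow> coshift k = 0"
  unfolding coshift_def H2.orth_proj_eq_0_iff
  by (simp add: cinner_mult_L2_left[OF Linf_cnj[OF \<theta>_Linf]] model_space_def)

text \<open>Paired with \<open>mult_theta h\<close>, both terms of \<open>model_proj x\<close> give
  \<open>cinner x (mult_theta h)\<close>, the second one because \<open>mult_theta\<close> preserves
  inner products.\<close>

lemma model_proj_mem: "model_proj x \<in> model_space \<theta>"
proof -
  have "cinner (model_proj x) (mult_theta h) = 0" if h: "h \<in> H2" for h
    using H2.orth_proj(2)[OF mult_theta_H2[OF h], of x] cinner_coshift[OF h, of x]
    by (simp add: model_proj_def cinner_diff_left cinner_mult_theta)
  moreover have "model_proj x \<in> H2"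
    unfolding model_proj_def
    by (intro complex_subspace_diff H2.subspace H2.orth_proj mult_theta_H2 coshift_H2)
  ultimately show ?thesis by (simp add: model_space_def mult_theta_def)
qed

lemma model_proj_H2: "model_proj x \<in> H2"
  using model_proj_mem model_space_subset_H2 by blast

lemma model_proj_orthogonal:
  assumes "k \<in> model_space \<theta>"
  shows "cinner (x - model_proj x) k = 0"
proof -
  have "cinner (mult_theta (coshift x)) k = cnj (cinner k (mult_theta (coshift x)))"
    by (rule cinner_commute)
  also have "\<dots> = 0"
    using assms coshift_H2 by (simp add: model_space_def mult_theta_def)
  finally show ?thesis
    using H2.orth_proj(2)[of k x] assms model_space_subset_H2
    by (auto simp: model_proj_def cinner_diff_left)
qed

lemma model_proj_ident: "k \<in> model_space \<theta> \<Longrightarrow> model_proj k = k"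
  using model_space_subset_H2
  by (auto simp: model_proj_def coshift_model_space H2.orth_proj_ident
      bounded_op_apply_zero[OF bounded_op_mult_theta])

lemma model_proj_eq_0:
  assumes "\<And>k. k \<in> model_space \<theta> \<Longrightarrow> cinner x k = 0"
  shows "model_proj x = 0"
proof -
  have "cinner (model_proj x) (model_proj x) = 0"
    using model_proj_orthogonal[OF model_proj_mem, of x x] assms[OF model_proj_mem, of x]
    by (simp add: cinner_diff_left)
  then show ?thesis by (simp add: cinner_self_eq_0)
qed

lemma model_proj_mult_theta: "x \<in> H2 \<Longrightarrow> model_proj (mult_theta x) = 0"
  by (simp add: model_proj_def coshift_mult_theta H2.orth_proj_ident mult_theta_H2)

lemma model_decomposition: "x \<in> H2 \<Longrightarrow> model_proj x + mult_theta (coshift x) = x"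
  by (simp add: model_proj_def H2.orth_proj_ident)

end

section \<open>The dual-band space and its projection\<close>

locale dual_band = inner_symbol +
  fixes \<phi> \<psi> :: "complex \<Rightarrow> complex"
  assumes phi: "\<phi> \<in> Linf" "unimodular \<phi>"
    and psi: "\<psi> \<in> Linf" "unimodular \<psi>"
    and orthogonal: "\<And>f h. f \<in> model_space \<theta> \<Longrightarrow> h \<in> model_space \<theta> \<Longrightarrow>
      cinner (mult_L2 \<phi> f) (mult_L2 \<psi> h) = 0"
begin

abbreviation "M \<equiv> dual_band_space \<theta> \<phi> \<psi>"

definition synth :: "L2 \<Rightarrow> L2 \<Rightarrow> L2" where
  "synth f h = mult_L2 \<phi> f + mult_L2 \<psi> h"

definition band1 :: "L2 \<Rightarrow> L2" where
  "band1 x = mult_L2 (\<lambda>z. cnj (\<phi> z)) x"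

definition band2 :: "L2 \<Rightarrow> L2" where
  "band2 x = mult_L2 (\<lambda>z. cnj (\<psi> z)) x"

lemma bounded_op_synth: "bounded_op S \<Longrightarrow> bounded_op T \<Longrightarrow> bounded_op (\<lambda>x. synth (S x) (T x))"
  unfolding synth_def
  by (rule bounded_op_add[OF bounded_op_compose[OF bounded_op_mult_L2[OF phi(1)]]
        bounded_op_compose[OF bounded_op_mult_L2[OF psi(1)]]])

lemma bounded_op_band1: "bounded_op band1"
  unfolding band1_def by (rule bounded_op_mult_L2[OF Linf_cnj[OF phi(1)]])

lemma bounded_op_band2: "bounded_op band2"
  unfolding band2_def by (rule bounded_op_mult_L2[OF Linf_cnj[OF psi(1)]])

text \<open>Conjugate multiplication undoes its own band by unimodularity. It sends the other band
  to something orthogonal to the model space, because the two bands are orthogonal, and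
  \<open>model_proj\<close> annihilates that.\<close>

lemma model_proj_bands_synth:
  assumes "f \<in> model_space \<theta>" "h \<in> model_space \<theta>"
  shows "model_proj (band1 (synth f h)) = f" "model_proj (band2 (synth f h)) = h"
proof -
  have "model_proj (band1 (mult_L2 \<psi> h)) = 0"
  proof (rule model_proj_eq_0)
    fix k assume k: "k \<in> model_space \<theta>"
    have "cinner (band1 (mult_L2 \<psi> h)) k = cinner (mult_L2 \<psi> h) (mult_L2 \<phi> k)"
      by (simp add: band1_def cinner_mult_L2_left Linf_cnj phi)
    also have "\<dots> = 0"
      using orthogonal[OF k assms(2)] cinner_commute[of "mult_L2 \<psi> h" "mult_L2 \<phi> k"] by simp
    finally show "cinner (band1 (mult_L2 \<psi> h)) k = 0" .
  qed
  then show "model_proj (band1 (synth f h)) = f"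
    using assms
    by (simp add: synth_def bounded_op_apply_add[OF bounded_op_band1]
        bounded_op_apply_add[OF bounded_op_model_proj] model_proj_ident)
      (simp add: band1_def mult_L2_cnj_unimodular phi model_proj_ident)
  have "model_proj (band2 (mult_L2 \<phi> f)) = 0"
  proof (rule model_proj_eq_0)
    fix k assume k: "k \<in> model_space \<theta>"
    have "cinner (band2 (mult_L2 \<phi> f)) k = cinner (mult_L2 \<phi> f) (mult_L2 \<psi> k)"
      by (simp add: band2_def cinner_mult_L2_left Linf_cnj psi)
    then show "cinner (band2 (mult_L2 \<phi> f)) k = 0" using orthogonal[OF assms(1) k] by simp
  qed
  then show "model_proj (band2 (synth f h)) = h"
    using assms
    by (simp add: synth_def bounded_op_apply_add[OF bounded_op_band2]
        bounded_op_apply_add[OF bounded_op_model_proj] model_proj_ident)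
      (simp add: band2_def mult_L2_cnj_unimodular psi model_proj_ident)
qed

lemma synth_mem: "f \<in> model_space \<theta> \<Longrightarrow> h \<in> model_space \<theta> \<Longrightarrow> synth f h \<in> M"
  by (auto simp: dual_band_space_def synth_def)

definition band_proj :: "L2 \<Rightarrow> L2" where
  "band_proj x = synth (model_proj (band1 x)) (model_proj (band2 x))"

lemma band_proj_ident:
  assumes "m \<in> M"
  shows "band_proj m = m"
proof -
  obtain f h where "f \<in> model_space \<theta>" "h \<in> model_space \<theta>" "m = synth f h"
    using assms by (auto simp: dual_band_space_def synth_def)
  then show ?thesis by (simp add: band_proj_def model_proj_bands_synth)
qed

lemma bounded_op_band_proj: "bounded_op band_proj"
  unfolding band_proj_def
  by (intro bounded_op_synth bounded_op_compose[OF bounded_op_model_proj] bounded_op_band1 bounded_op_band2)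

lemma band_proj_mem: "band_proj x \<in> M"
  unfolding band_proj_def by (intro synth_mem model_proj_mem)

text \<open>\<open>M\<close> is the set of fixed points of the bounded operator
  \<open>band_proj\<close>, hence a closed subspace.\<close>

sublocale M: closed_subspace M
proof
  have "x \<in> M \<longleftrightarrow> band_proj x = x" for x
    using band_proj_ident[of x] band_proj_mem[of x] by auto
  then have eq: "M = {x. band_proj x = x}" by blast
  show "complex_subspace M"
    unfolding eq using bounded_op_band_proj
    by (auto simp: complex_subspace_def bounded_operator_def bounded_op_apply_zero[OF bounded_op_band_proj])
  show "closed M"
    unfolding eq
    by (intro closed_Collect_eq continuous_on_id linear_continuous_on
        bounded_op_imp_bounded_linear bounded_op_band_proj)
qed

text \<open>Both model components of \<open>x - band_proj x\<close> vanish, and by adjunction its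
  inner product with \<open>synth f h\<close> only sees these components.\<close>

lemma orth_proj_dual_band: "orth_proj M x = band_proj x"
proof (rule M.orth_proj_unique[OF band_proj_mem])
  fix m assume "m \<in> M"
  then obtain f h where fh: "f \<in> model_space \<theta>" "h \<in> model_space \<theta>" "m = synth f h"
    by (auto simp: dual_band_space_def synth_def)
  let ?d = "x - band_proj x"
  have 1: "model_proj (band1 ?d) = 0" "model_proj (band2 ?d) = 0"
    unfolding bounded_op_apply_diff[OF bounded_op_band1] bounded_op_apply_diff[OF bounded_op_band2]
      bounded_op_apply_diff[OF bounded_op_model_proj] band_proj_def
    by (simp_all add: model_proj_bands_synth model_proj_mem)
  have "cinner ?d m = cinner (band1 ?d) f + cinner (band2 ?d) h"
    by (simp add: fh(3) synth_def cinner_add_right band1_def band2_def cinner_mult_L2_left Linf_cnj phi psi)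
  also have "\<dots> = 0"
    using model_proj_orthogonal[OF fh(1), of "band1 ?d"] model_proj_orthogonal[OF fh(2), of "band2 ?d"] 1
    by simp
  finally show "cinner ?d m = 0" .
qed

end


section \<open>Equivalence after extension\<close>

locale dual_band_operator = dual_band +
  fixes g :: "complex \<Rightarrow> complex"
  assumes g: "g \<in> Linf"
begin

text \<open>The lower left block of the symbol is multiplication by \<open>g\<close> between the row
  \<open>(\<phi>, \<psi>)\<close>, which is \<open>synth\<close>, and its conjugate column. This
  common factor also appears in the compression to \<open>M\<close>.\<close>

definition symbol_row1 :: "L2 \<Rightarrow> L2 \<Rightarrow> L2" where
  "symbol_row1 u v = band1 (mult_L2 g (synth u v))"

definition symbol_row2 :: "L2 \<Rightarrow> L2 \<Rightarrow> L2" where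
  "symbol_row2 u v = band2 (mult_L2 g (synth u v))"

lemma bounded_op_symbol_row:
  assumes "bounded_op S" "bounded_op T"
  shows "bounded_op (\<lambda>x. symbol_row1 (S x) (T x))" "bounded_op (\<lambda>x. symbol_row2 (S x) (T x))"
  unfolding symbol_row1_def symbol_row2_def
  by (rule bounded_op_compose[OF bounded_op_band1 bounded_op_compose[OF bounded_op_mult_L2[OF g] bounded_op_synth[OF assms]]]
      bounded_op_compose[OF bounded_op_band2 bounded_op_compose[OF bounded_op_mult_L2[OF g] bounded_op_synth[OF assms]]])+

lemma synth_add: "synth (a + b) (c + d) = synth a c + synth b d"
  by (simp add: synth_def mult_L2_add phi psi)

lemma symbol_row_add:
  "symbol_row1 (a + b) (c + d) = symbol_row1 a c + symbol_row1 b d"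
  "symbol_row2 (a + b) (c + d) = symbol_row2 a c + symbol_row2 b d"
  by (simp_all add: symbol_row1_def symbol_row2_def synth_add mult_L2_add g
      bounded_op_apply_add[OF bounded_op_band1] bounded_op_apply_add[OF bounded_op_band2])

lemma compressed_mult_eq:
  assumes "m \<in> M"
  shows "compressed_mult M g m =
    synth (model_proj (symbol_row1 (model_proj (band1 m)) (model_proj (band2 m))))
      (model_proj (symbol_row2 (model_proj (band1 m)) (model_proj (band2 m))))"
proof -
  have "synth (model_proj (band1 m)) (model_proj (band2 m)) = m"
    using band_proj_ident[OF assms] by (simp add: band_proj_def)
  then show ?thesis
    by (simp add: compressed_mult_def orth_proj_dual_band symbol_row1_def symbol_row2_def band_proj_def)
qed

abbreviation "G \<equiv> dual_band_symbol \<theta> \<phi> \<psi> g"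

text \<open>By unimodularity the diagonal entries \<open>g\<close> of the block equal
  \<open>cnj \<phi> * g * \<phi>\<close> and \<open>cnj \<psi> * g * \<psi>\<close>, so the whole
  block factors through \<open>synth\<close>.\<close>

lemma toeplitz_symbol:
  "toeplitz G u = vector [coshift (u $ 1), coshift (u $ 2),
    orth_proj H2 (symbol_row1 (u $ 1) (u $ 2) + mult_theta (u $ 3)),
    orth_proj H2 (symbol_row2 (u $ 1) (u $ 2) + mult_theta (u $ 4))]"
proof -
  have 1: "mult_L2 (\<lambda>z. g z * cnj (\<phi> z) * \<psi> z) x = mult_L2 (\<lambda>z. cnj (\<phi> z)) (mult_L2 g (mult_L2 \<psi> x))" for x
    by (simp add: mult_L2_mult Linf_mult Linf_cnj g phi psi mult_L2_commute[of g])
  have 2: "mult_L2 (\<lambda>z. g z * \<phi> z * cnj (\<psi> z)) x = mult_L2 (\<lambda>z. cnj (\<psi> z)) (mult_L2 g (mult_L2 \<phi> x))" for x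
    by (subst mult_L2_commute)
      (simp_all add: mult_L2_mult Linf_mult Linf_cnj g phi psi mult_L2_commute[of \<phi>])
  have 3: "mult_L2 (\<lambda>z. cnj (\<phi> z)) (mult_L2 g (mult_L2 \<phi> x)) = mult_L2 g x" for x
    by (subst mult_L2_commute) (simp_all add: mult_L2_cnj_unimodular Linf_cnj g phi)
  have 4: "mult_L2 (\<lambda>z. cnj (\<psi> z)) (mult_L2 g (mult_L2 \<psi> x)) = mult_L2 g x" for x
    by (subst mult_L2_commute) (simp_all add: mult_L2_cnj_unimodular Linf_cnj g psi)
  have "symbol_row1 (u $ 1) (u $ 2) = mult_L2 g (u $ 1) + mult_L2 (\<lambda>z. g z * cnj (\<phi> z) * \<psi> z) (u $ 2)"
    "symbol_row2 (u $ 1) (u $ 2) = mult_L2 (\<lambda>z. g z * \<phi> z * cnj (\<psi> z)) (u $ 1) + mult_L2 g (u $ 2)"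
    unfolding 1 2
    by (simp_all add: symbol_row1_def symbol_row2_def band1_def band2_def synth_def mult_L2_add phi psi Linf_cnj g 3 4)
  then show ?thesis
    by (simp add: vec_eq_iff forall_4 vector_4 toeplitz_def sum_4 dual_band_symbol_def coshift_def mult_theta_def)
qed

lemma symbol_Linf: "(\<lambda>z. G z $ i $ j) \<in> Linf"
proof -
  have "\<forall>i j. (\<lambda>z. G z $ i $ j) \<in> Linf"
    by (simp add: forall_4 dual_band_symbol_def vector_4 Linf_const Linf_cnj Linf_mult \<theta>_Linf phi psi g)
  then show ?thesis by blast
qed

text \<open>\<open>Y\<^sub>0\<close> is \<open>{0}\<close>, and \<open>X\<^sub>0\<close> is
  \<open>H2_vec\<close>, which carries the identity on \<open>(w, v)\<close>. The model part of the
  lower entries, freed from the contribution of \<open>w = (y $ 1, y $ 2)\<close>, goes to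
  \<open>M\<close>; the remaining part, divided by \<open>\<theta>\<close>, goes to the last two
  entries.\<close>

definition E :: "(L2 ^ 4) \<times> L2 \<Rightarrow> L2 \<times> (L2 ^ 4)" where
  "E p = (let y = fst p; a = mult_theta (y $ 1); b = mult_theta (y $ 2) in
    (synth (model_proj (y $ 3 - symbol_row1 a b)) (model_proj (y $ 4 - symbol_row2 a b)),
     vector [y $ 1, y $ 2, coshift (y $ 3), coshift (y $ 4)]))"

definition E_inv :: "L2 \<times> (L2 ^ 4) \<Rightarrow> (L2 ^ 4) \<times> L2" where
  "E_inv p = (let m = fst p; x = snd p; a = mult_theta (x $ 1); b = mult_theta (x $ 2) in
    (vector [x $ 1, x $ 2, model_proj (band1 m) + model_proj (symbol_row1 a b) + mult_theta (x $ 3),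
       model_proj (band2 m) + model_proj (symbol_row2 a b) + mult_theta (x $ 4)], 0))"

text \<open>The upper entries reassemble \<open>u = k + \<theta> w\<close>, with \<open>k\<close>
  read off from \<open>m\<close> and \<open>w\<close> from \<open>x\<close>. The lower ones change
  \<open>v\<close> so that the part of the symbol rows in \<open>\<theta> H2\<close>
  cancels.\<close>

definition F :: "L2 \<times> (L2 ^ 4) \<Rightarrow> (L2 ^ 4) \<times> L2" where
  "F p = (let m = fst p; x = snd p;
      a = model_proj (band1 m) + mult_theta (x $ 1); b = model_proj (band2 m) + mult_theta (x $ 2) in
    (vector [a, b, x $ 3 - coshift (symbol_row1 a b), x $ 4 - coshift (symbol_row2 a b)], 0))"

definition F_inv :: "(L2 ^ 4) \<times> L2 \<Rightarrow> L2 \<times> (L2 ^ 4)" where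
  "F_inv p = (let u = fst p in
    (synth (model_proj (u $ 1)) (model_proj (u $ 2)),
     vector [coshift (u $ 1), coshift (u $ 2), u $ 3 + coshift (symbol_row1 (u $ 1) (u $ 2)),
       u $ 4 + coshift (symbol_row2 (u $ 1) (u $ 2))]))"

lemmas bounded_op_rules = bounded_op_Pair bounded_op_vector_4 bounded_op_zero bounded_op_synth bounded_op_symbol_row
  bounded_op_add bounded_op_diff bounded_op_vec_nth bounded_op_fst bounded_op_snd bounded_op_ident
  bounded_op_compose[OF bounded_op_model_proj] bounded_op_compose[OF bounded_op_coshift]
  bounded_op_compose[OF bounded_op_mult_theta] bounded_op_compose[OF bounded_op_band1]
  bounded_op_compose[OF bounded_op_band2]

lemma bounded_op_factors: "bounded_op E" "bounded_op E_inv" "bounded_op F" "bounded_op F_inv"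
  unfolding E_def E_inv_def F_def F_inv_def Let_def by (intro bounded_op_rules)+

lemmas H2_add = H2.subspace[unfolded complex_subspace_def, THEN conjunct2, THEN conjunct1, rule_format]

lemmas H2_rules = complex_subspace_diff[OF H2.subspace] H2_add coshift_H2 mult_theta_H2 model_proj_H2

section \<open>Mutual inverses and the factorization\<close>

lemma factors_mem:
  "y \<in> H2_vec \<times> {0} \<Longrightarrow> E y \<in> M \<times> H2_vec"
  "p \<in> M \<times> H2_vec \<Longrightarrow> E_inv p \<in> H2_vec \<times> {0}"
  "p \<in> M \<times> H2_vec \<Longrightarrow> F p \<in> H2_vec \<times> {0}"
  "y \<in> H2_vec \<times> {0} \<Longrightarrow> F_inv y \<in> M \<times> H2_vec"
  unfolding E_def E_inv_def F_def F_inv_def Let_def mem_Times_iff fst_conv snd_conv H2_vec_4_iff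
  by (intro conjI synth_mem model_proj_mem H2_rules insertI1; simp add: H2_vec_def)+

lemmas op_add = bounded_op_apply_add[OF bounded_op_model_proj] bounded_op_apply_add[OF bounded_op_coshift]
  bounded_op_apply_add[OF bounded_op_mult_theta]

lemmas op_diff = bounded_op_apply_diff[OF bounded_op_model_proj]
  bounded_op_apply_diff[OF bounded_op_coshift] bounded_op_apply_diff[OF bounded_op_mult_theta]

lemmas model_simps = op_add op_diff model_proj_ident[OF model_proj_mem] coshift_model_space[OF model_proj_mem]
  coshift_mult_theta model_proj_mult_theta model_proj_bands_synth[OF model_proj_mem model_proj_mem] vector_4

lemma F_inv_F: "p \<in> M \<times> H2_vec \<Longrightarrow> F_inv (F p) = p"
  and E_E_inv: "p \<in> M \<times> H2_vec \<Longrightarrow> E (E_inv p) = p"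
proof -
  assume p: "p \<in> M \<times> H2_vec"
  then obtain m x where mx: "p = (m, x)" "m \<in> M" "\<And>i. x $ i \<in> H2"
    by (auto simp: H2_vec_def)
  have m: "synth (model_proj (band1 m)) (model_proj (band2 m)) = m"
    using band_proj_ident[OF mx(2)] by (simp add: band_proj_def)
  show "F_inv (F p) = p"
    by (simp add: mx(1,3) F_def F_inv_def Let_def model_simps m vec_eq_iff forall_4)
  show "E (E_inv p) = p"
    by (simp add: mx(1,3) E_def E_inv_def Let_def model_simps m vec_eq_iff forall_4)
qed

lemma F_F_inv: "y \<in> H2_vec \<times> {0} \<Longrightarrow> F (F_inv y) = y"
  and E_inv_E: "y \<in> H2_vec \<times> {0} \<Longrightarrow> E_inv (E y) = y"
proof -
  assume y: "y \<in> H2_vec \<times> {0}"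
  then obtain u where u: "y = (u, 0)" "\<And>i. u $ i \<in> H2"
    by (auto simp: H2_vec_def)
  show "F (F_inv y) = y"
    by (simp add: u F_def F_inv_def Let_def model_simps model_decomposition vec_eq_iff forall_4)
  \<comment> \<open>The model components of the synthesized element are recovered first; only then
    are they expanded by linearity.\<close>
  show "E_inv (E y) = y"
    by (simp add: u E_def E_inv_def Let_def vector_4 model_proj_bands_synth model_proj_mem vec_eq_iff forall_4)
      (simp add: u model_simps model_decomposition)
qed

text \<open>The purpose of the shift by \<open>coshift w\<close>: the second summand lies in
  \<open>H2\<close> and is left fixed, and its part \<open>- mult_theta (coshift w)\<close> turns
  the projection of \<open>w\<close> to \<open>H2\<close> into \<open>model_proj w\<close>.\<close>

lemma orth_proj_add_mult_theta:
  assumes "x \<in> H2"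
  shows "orth_proj H2 (w + mult_theta (x - coshift w)) = model_proj w + mult_theta x"
  using H2.orth_proj_ident[OF mult_theta_H2, of "x - coshift w"] assms
  by (simp add: bounded_op_apply_add[OF H2.bounded_op_orth_proj] model_proj_def op_diff H2_rules)

text \<open>After \<open>F\<close>, the Toeplitz operator returns \<open>w\<close> in the upper
  entries and the model part of the block at \<open>u\<close> plus \<open>\<theta> v\<close> in the
  lower ones. \<open>E\<close> subtracts the contribution of \<open>\<theta> w\<close>, leaving the
  block at \<open>k\<close>, which \<open>synth\<close> turns into the compression;
  \<open>coshift\<close> annihilates the model part and returns \<open>v\<close>.\<close>

lemma factorization:
  assumes "p \<in> M \<times> H2_vec"
  shows "map_prod (compressed_mult M g) id p = E (map_prod (toeplitz G) id (F p))"
proof -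
  obtain m x where mx: "p = (m, x)" "m \<in> M" "\<And>i. x $ i \<in> H2"
    using assms by (auto simp: H2_vec_def)
  show ?thesis
    by (simp add: mx E_def F_def Let_def toeplitz_symbol compressed_mult_eq orth_proj_add_mult_theta
        vector_4 vec_eq_iff forall_4)
      (simp add: mx model_simps symbol_row_add)
qed

lemma equivalent_after_extension_toeplitz:
  "equivalent_after_extension TYPE(L2 ^ 4) TYPE(L2) M M (compressed_mult M g) H2_vec H2_vec (toeplitz G)"
  unfolding equivalent_after_extension_def
proof (intro conjI, goal_cases)
  \<comment> \<open>The last conjunct asks for the factors; the third and sixth are boundedness of
    the two operators, the others completeness of the carriers.\<close>
  case 7
  have zero: "complex_banach {0 :: L2}"
    by (simp add: complex_banach_def complex_subspace_def complete_eq_closed)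
  have E: "invertible_operator (H2_vec \<times> {0}) (M \<times> H2_vec) E"
    unfolding invertible_operator_def
    by (rule conjI[OF bounded_op_restrict[OF bounded_op_factors(1) factors_mem(1)]],
        (assumption | rule exI[of _ E_inv] conjI ballI E_inv_E E_E_inv
          bounded_op_restrict[OF bounded_op_factors(2) factors_mem(2)])+)
  have F: "invertible_operator (M \<times> H2_vec) (H2_vec \<times> {0}) F"
    unfolding invertible_operator_def
    by (rule conjI[OF bounded_op_restrict[OF bounded_op_factors(3) factors_mem(3)]],
        (assumption | rule exI[of _ F_inv] conjI ballI F_inv_F F_F_inv
          bounded_op_restrict[OF bounded_op_factors(4) factors_mem(4)])+)
  show ?case
    by (rule exI[of _ H2_vec], rule exI[of _ "{0}"], rule exI[of _ E], rule exI[of _ F])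
      (intro conjI ballI complex_banach_H2_vec zero E F factorization)
next
  case 3
  show ?case
    unfolding compressed_mult_def
    by (rule bounded_op_restrict[OF bounded_op_compose[OF M.bounded_op_orth_proj bounded_op_mult_L2[OF g]]
          M.orth_proj(1)])
next
  case 6
  show ?case by (rule bounded_op_restrict[OF bounded_op_toeplitz[OF symbol_Linf] toeplitz_in_H2_vec])
qed (rule M.complex_banach complex_banach_H2_vec)+

end

theorem corollary3p3:
  fixes \<theta> \<phi> \<psi> g :: "complex \<Rightarrow> complex"
  assumes "inner_function \<theta>"
    and "\<phi> \<in> Linf" "unimodular \<phi>"
    and "\<psi> \<in> Linf" "unimodular \<psi>"
    and "\<forall>f\<in>model_space \<theta>. \<forall>h\<in>model_space \<theta>. cinner (mult_L2 \<phi> f) (mult_L2 \<psi> h) = 0"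
    and "\<not> (\<exists>c. AE z in circle. \<phi> z * cnj (\<psi> z) = c * \<theta> z)"
    and "\<not> (\<exists>c. AE z in circle. cnj (\<phi> z) * \<psi> z = c * \<theta> z)"
    and "g \<in> Linf"
  shows "equivalent_after_extension TYPE(L2 ^ 4) TYPE(L2)
    (dual_band_space \<theta> \<phi> \<psi>) (dual_band_space \<theta> \<phi> \<psi>)
    (compressed_mult (dual_band_space \<theta> \<phi> \<psi>) g)
    H2_vec H2_vec (toeplitz (dual_band_symbol \<theta> \<phi> \<psi> g))"
proof -
  interpret dual_band_operator \<theta> \<phi> \<psi> g
    by unfold_locales (use assms in auto)
  show ?thesis by (rule equivalent_after_extension_toeplitz)
qed

end
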